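(* Let $n\ge2$. For $x,y\in\mathbb{B}^n$ and $r=\max\{|x|,|y|\}$, $$\frac12\,\rho_{\mathbb{B}^n}(x,y)\le j_{\mathbb{B}^n}(x,y)\le\frac{1+r}{2}\,\rho_{\mathbb{B}^n}(x,y),$$ and $$\frac12\,\rho_{\mathbb{B}^n}(x,y)\le k_{\mathbb{B}^n}(x,y)\le\frac{1+r}{2}\,\rho_{\mathbb{B}^n}(x,y).$$
   Context: $\mathbb{B}^n=\{x\in\mathbb{R}^n:|x|<1\}$. The hyperbolic metric of the unit ball is $$\rho_{\mathbb{B}^n}(x,y)=\inf_{\gamma\in\Gamma}\int_\gamma\frac{2|dz|}{1-|z|^2},$$ the infimum being over the family $\Gamma$ of all rectifiable curves in $\mathbb{B}^n$ joining $x$ and $y$; equivalently $\sinh^2\left(\tfrac12\rho_{\mathbb{B}^n}(x,y)\right)=\frac{|x-y|^2}{(1-|x|^2)(1-|y|^2)}$. The quasihyperbolic metric of the unit ball is $$k_{\mathbb{B}^n}(x,y)=\inf_{\gamma\in\Gamma}\int_\gamma\frac{|dz|}{1-|z|},$$ and the distance-ratio metric of the unit ball is $$j_{\mathbb{B}^n}(x,y)=\log\left(1+\frac{|x-y|}{\min\{1-|x|,1-|y|\}}\right).$$ *)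

theory Defs
  imports "HOL-Analysis.Analysis"
begin

section \<open>Rectifiable curves and integration with respect to arc length\<close>

text \<open>Curves are paths in the sense of \<^const>\<open>path\<close>, i.e. parametrized over \<open>{0..1}\<close>.\<close>

text \<open>The nodes need not include \<open>a\<close> and \<open>b\<close>; adding them only increases the sum, so the
  supremum of this set is the usual length of \<open>\<gamma>\<close> on \<open>{a..b}\<close>.\<close>

definition inscribed_lengths :: "(real \<Rightarrow> 'a::metric_space) \<Rightarrow> real \<Rightarrow> real \<Rightarrow> real set" where
  "inscribed_lengths \<gamma> a b =
     {\<Sum>i<m. dist (\<gamma> (t i)) (\<gamma> (t (Suc i))) | (t :: nat \<Rightarrow> real) (m :: nat).
        incseq t \<and> range t \<subseteq> {a..b}}"

definition rectifiable_path :: "(real \<Rightarrow> 'a::metric_space) \<Rightarrow> bool" where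
  "rectifiable_path \<gamma> \<longleftrightarrow> path \<gamma> \<and> bdd_above (inscribed_lengths \<gamma> 0 1)"

text \<open>The arc length of \<open>\<gamma>\<close> from parameter 0 to parameter \<open>u\<close>. It is extended by constants
  outside \<open>{0..1}\<close>; for a rectifiable path it is then a continuous nondecreasing function
  on the whole real line, as required by \<^const>\<open>interval_measure\<close>.\<close>

definition arc_length_fun :: "(real \<Rightarrow> 'a::metric_space) \<Rightarrow> real \<Rightarrow> real" where
  "arc_length_fun \<gamma> u = Sup (inscribed_lengths \<gamma> 0 (max 0 (min 1 u)))"

text \<open>The integral of \<open>w(z) |dz|\<close> along \<open>\<gamma>\<close>, as the Lebesgue-Stieltjes integral of \<open>w \<circ> \<gamma>\<close>
  with respect to the arc length function.\<close>

definition arc_length_integral :: "(real \<Rightarrow> 'a::metric_space) \<Rightarrow> ('a \<Rightarrow> real) \<Rightarrow> real" where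
  "arc_length_integral \<gamma> w =
     set_lebesgue_integral (interval_measure (arc_length_fun \<gamma>)) {0..1} (\<lambda>u. w (\<gamma> u))"

definition joining_paths :: "'a::metric_space set \<Rightarrow> 'a \<Rightarrow> 'a \<Rightarrow> (real \<Rightarrow> 'a) set" where
  "joining_paths U x y =
     {\<gamma>. rectifiable_path \<gamma> \<and> path_image \<gamma> \<subseteq> U \<and> pathstart \<gamma> = x \<and> pathfinish \<gamma> = y}"


section \<open>Metrics of the unit ball\<close>

text \<open>For points of the ball the real-valued infima below are genuine: the segment is a joining
  path, and all the integrals are nonnegative.\<close>

definition hyperbolic_dist :: "'a::euclidean_space \<Rightarrow> 'a \<Rightarrow> real" where
  "hyperbolic_dist x y =
     (INF \<gamma>\<in>joining_paths (ball 0 1) x y. arc_length_integral \<gamma> (\<lambda>z. 2 / (1 - (norm z)\<^sup>2)))"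

definition quasihyperbolic_dist :: "'a::euclidean_space \<Rightarrow> 'a \<Rightarrow> real" where
  "quasihyperbolic_dist x y =
     (INF \<gamma>\<in>joining_paths (ball 0 1) x y. arc_length_integral \<gamma> (\<lambda>z. 1 / (1 - norm z)))"

definition distance_ratio :: "'a::euclidean_space \<Rightarrow> 'a \<Rightarrow> real" where
  "distance_ratio x y = ln (1 + norm (x - y) / min (1 - norm x) (1 - norm y))"

end

theory Submission
  imports Defs
begin

text \<open>Both upper bounds by the hyperbolic distance follow from \<open>j \<le> k \<le> (1 + r) / 2 * \<rho>\<close>. For the second
  inequality, the nearest point projection onto the closed ball of radius \<open>r\<close> fixes \<open>x\<close> and \<open>y\<close>,
  shortens curves and decreases norms, so it does not increase hyperbolic lengths; and on that
  ball the quasihyperbolic density is at most \<open>(1 + r) / 2\<close> times the hyperbolic one. For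
  \<open>j \<le> k\<close>, the distance to the sphere grows at most like arc length, which bounds the density from
  below along a curve by the derivative of a logarithm. The inequality \<open>\<rho> \<le> 2 * k\<close> is a pointwise
  comparison of densities. Finally, \<open>\<rho> \<le> 2 * j\<close> requires a curve that is short enough: the
  hyperbolic geodesic, whose length is computed in the hyperboloid model and then compared
  with \<open>2 * j\<close> using \<open>|x - y| \<le> |x| + |y|\<close>.\<close>

section \<open>Arc length\<close>

definition arc_length :: "(real \<Rightarrow> 'a::metric_space) \<Rightarrow> real \<Rightarrow> real \<Rightarrow> real" where
  "arc_length \<gamma> a b = Sup (inscribed_lengths \<gamma> a b)"

section \<open>Inscribed polygons and additivity of arc length\<close>

lemma inscribed_lengthsI:
  "incseq t \<Longrightarrow> range t \<subseteq> {a..b} \<Longrightarrow> (\<Sum>i<m. dist (\<gamma> (t i)) (\<gamma> (t (Suc i)))) \<in> inscribed_lengths \<gamma> a b"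
  unfolding inscribed_lengths_def by blast

lemma inscribed_lengths_mono: "a' \<le> a \<Longrightarrow> b \<le> b' \<Longrightarrow> inscribed_lengths \<gamma> a b \<subseteq> inscribed_lengths \<gamma> a' b'"
  unfolding inscribed_lengths_def by fastforce

lemma dist_in_inscribed_lengths:
  assumes "a \<le> b"
  shows "dist (\<gamma> a) (\<gamma> b) \<in> inscribed_lengths \<gamma> a b"
proof -
  have "(\<Sum>i<1. dist (\<gamma> ((\<lambda>i. if i = 0 then a else b) i)) (\<gamma> ((\<lambda>i. if i = 0 then a else b) (Suc i))))
      \<in> inscribed_lengths \<gamma> a b"
    by (rule inscribed_lengthsI) (use assms in \<open>auto simp: incseq_def\<close>)
  then show ?thesis by simp
qed

lemma dist_le_arc_length:
  assumes "a \<le> b" "bdd_above (inscribed_lengths \<gamma> a b)"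
  shows "dist (\<gamma> a) (\<gamma> b) \<le> arc_length \<gamma> a b"
  unfolding arc_length_def using assms by (intro cSup_upper dist_in_inscribed_lengths)

lemma arc_length_least:
  assumes "a \<le> b"
    and "\<And>t m. incseq t \<Longrightarrow> range t \<subseteq> {a..b} \<Longrightarrow> (\<Sum>i<m. dist (\<gamma> (t i)) (\<gamma> (t (Suc i)))) \<le> B"
  shows "arc_length \<gamma> a b \<le> B"
  unfolding arc_length_def
proof (rule cSup_least)
  show "inscribed_lengths \<gamma> a b \<noteq> {}" using dist_in_inscribed_lengths[OF assms(1)] by blast
qed (use assms(2) in \<open>auto simp: inscribed_lengths_def\<close>)

lemma inscribed_length_le_arc_length:
  assumes "bdd_above (inscribed_lengths \<gamma> a b)" "incseq t" "range t \<subseteq> {a..b}"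
  shows "(\<Sum>i<m. dist (\<gamma> (t i)) (\<gamma> (t (Suc i)))) \<le> arc_length \<gamma> a b"
  unfolding arc_length_def using assms by (intro cSup_upper inscribed_lengthsI)

text \<open>Cutting the nodes off at \<open>b\<close> keeps them monotone, so they become admissible
  nodes for one of the two halves.\<close>

lemma truncated_length_le_arc_length:
  fixes t :: "nat \<Rightarrow> real"
  assumes t: "incseq t" "range t \<subseteq> {a..c}" and ab: "a \<le> b" "b \<le> c"
    and bdd: "bdd_above (inscribed_lengths \<gamma> a c)"
  shows "(\<Sum>i<m. dist (\<gamma> (min (t i) b)) (\<gamma> (min (t (Suc i)) b))) \<le> arc_length \<gamma> a b"
    and "(\<Sum>i<m. dist (\<gamma> (max (t i) b)) (\<gamma> (max (t (Suc i)) b))) \<le> arc_length \<gamma> b c"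
proof -
  have mono: "min (t i) b \<le> min (t j) b" "max (t i) b \<le> max (t j) b" if "i \<le> j" for i j
    using incseqD[OF t(1) that] by auto
  have t_in: "a \<le> t i" "t i \<le> c" for i using t(2) by (auto simp: image_subset_iff)
  have "bdd_above (inscribed_lengths \<gamma> a b)" "bdd_above (inscribed_lengths \<gamma> b c)"
    using bdd_above_mono[OF bdd inscribed_lengths_mono] ab by auto
  then show "(\<Sum>i<m. dist (\<gamma> (min (t i) b)) (\<gamma> (min (t (Suc i)) b))) \<le> arc_length \<gamma> a b"
    "(\<Sum>i<m. dist (\<gamma> (max (t i) b)) (\<gamma> (max (t (Suc i)) b))) \<le> arc_length \<gamma> b c"
    using mono t_in ab by (auto intro!: inscribed_length_le_arc_length simp: incseq_def)
qed

text \<open>Truncating the nodes at \<open>b\<close> from above and from below leaves the index range unchanged.\<close>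

lemma inscribed_length_split:
  fixes t :: "nat \<Rightarrow> real"
  assumes "incseq t"
  shows "(\<Sum>i<m. dist (\<gamma> (t i)) (\<gamma> (t (Suc i)))) \<le>
     (\<Sum>i<m. dist (\<gamma> (min (t i) b)) (\<gamma> (min (t (Suc i)) b))) +
     (\<Sum>i<m. dist (\<gamma> (max (t i) b)) (\<gamma> (max (t (Suc i)) b)))"
  unfolding sum.distrib[symmetric]
proof (rule sum_mono)
  fix i
  have "t i \<le> t (Suc i)" using assms by (simp add: incseq_SucD)
  \<comment> \<open>If both nodes lie on the same side of \<open>b\<close>, one summand is the
    left-hand side and the other is zero; a pair straddling \<open>b\<close> is the triangle
    inequality through \<open>\<gamma> b\<close>.\<close>
  then show "dist (\<gamma> (t i)) (\<gamma> (t (Suc i))) \<le> dist (\<gamma> (min (t i) b)) (\<gamma> (min (t (Suc i)) b)) +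
     dist (\<gamma> (max (t i) b)) (\<gamma> (max (t (Suc i)) b))"
    by (auto simp: min_def max_def dist_triangle)
qed

lemma inscribed_lengths_concat:
  assumes "p \<in> inscribed_lengths \<gamma> a b" "q \<in> inscribed_lengths \<gamma> b c" "a \<le> b" "b \<le> c"
  shows "\<exists>s\<in>inscribed_lengths \<gamma> a c. p + q \<le> s"
proof -
  obtain t m where t: "incseq t" "range t \<subseteq> {a..b}" "p = (\<Sum>i<m. dist (\<gamma> (t i)) (\<gamma> (t (Suc i))))"
    using assms(1) unfolding inscribed_lengths_def by blast
  obtain t' m' where t': "incseq t'" "range t' \<subseteq> {b..c}" "q = (\<Sum>i<m'. dist (\<gamma> (t' i)) (\<gamma> (t' (Suc i))))"
    using assms(2) unfolding inscribed_lengths_def by blast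
  \<comment> \<open>The nodes \<open>t 0, ..., t m\<close> are followed by
    \<open>t' 0, t' 1, ...\<close>. The jump from \<open>t m\<close> to \<open>t' 0\<close> adds a
    nonnegative summand, so the new sum dominates \<open>p + q\<close> without having to equal
    it.\<close>
  define s where "s i = (if i \<le> m then t i else t' (i - Suc m))" for i
  have tab: "a \<le> t i" "t i \<le> b" "b \<le> t' i" "t' i \<le> c" for i
    using t(2) t'(2) by (auto simp: image_subset_iff)
  have s: "incseq s"
    unfolding incseq_def
  proof (intro allI impI)
    fix i j :: nat assume "i \<le> j"
    then show "s i \<le> s j"
      using tab(2)[of i] tab(3)[of "j - Suc m"] incseqD[OF t(1) \<open>i \<le> j\<close>]
        incseqD[OF t'(1), of "i - Suc m" "j - Suc m"]
      by (auto simp: s_def)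
  qed
  have "range s \<subseteq> {a..c}"
    using tab assms(3,4) by (auto simp: s_def image_subset_iff intro: order_trans[of a b] order_trans[of _ b c])
  then have mem: "(\<Sum>i<Suc m + m'. dist (\<gamma> (s i)) (\<gamma> (s (Suc i)))) \<in> inscribed_lengths \<gamma> a c"
    using s by (intro inscribed_lengthsI)
  have "(\<Sum>i<Suc m + m'. dist (\<gamma> (s i)) (\<gamma> (s (Suc i)))) =
     (\<Sum>i<Suc m. dist (\<gamma> (s i)) (\<gamma> (s (Suc i)))) + (\<Sum>i<m'. dist (\<gamma> (s (Suc m + i))) (\<gamma> (s (Suc (Suc m + i)))))"
    by (induction m') auto
  also have "(\<Sum>i<m'. dist (\<gamma> (s (Suc m + i))) (\<gamma> (s (Suc (Suc m + i))))) = q"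
    unfolding t'(3) by (simp add: s_def)
  also have "(\<Sum>i<Suc m. dist (\<gamma> (s i)) (\<gamma> (s (Suc i)))) \<ge> p"
  proof -
    have "(\<Sum>i<m. dist (\<gamma> (s i)) (\<gamma> (s (Suc i)))) = p"
      unfolding t(3) by (rule sum.cong) (auto simp: s_def)
    then show ?thesis by simp
  qed
  ultimately show ?thesis using mem by (metis add_right_mono)
qed

text \<open>Truncating nodes at \<open>b\<close> gives one inequality, concatenating nodes the
  other.\<close>

lemma arc_length_add:
  assumes ab: "a \<le> b" "b \<le> c" and bdd: "bdd_above (inscribed_lengths \<gamma> a c)"
  shows "arc_length \<gamma> a c = arc_length \<gamma> a b + arc_length \<gamma> b c"
proof (rule antisym)
  show "arc_length \<gamma> a c \<le> arc_length \<gamma> a b + arc_length \<gamma> b c"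
  proof (rule arc_length_least)
    fix t :: "nat \<Rightarrow> real" and m
    assume t: "incseq t" "range t \<subseteq> {a..c}"
    show "(\<Sum>i<m. dist (\<gamma> (t i)) (\<gamma> (t (Suc i)))) \<le> arc_length \<gamma> a b + arc_length \<gamma> b c"
      using truncated_length_le_arc_length[OF t ab bdd, of m] inscribed_length_split[OF t(1), of \<gamma> m b] by linarith
  qed (use ab in auto)
  have ne: "inscribed_lengths \<gamma> a b \<noteq> {}" "inscribed_lengths \<gamma> b c \<noteq> {}"
    using dist_in_inscribed_lengths ab by blast+
  have *: "p + q \<le> arc_length \<gamma> a c"
    if p: "p \<in> inscribed_lengths \<gamma> a b" and q: "q \<in> inscribed_lengths \<gamma> b c" for p q
    using inscribed_lengths_concat[OF p q ab] bdd unfolding arc_length_def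
    by (meson cSup_upper order_trans)
  \<comment> \<open>The two suprema are taken one after the other: first over \<open>q\<close> with
    \<open>p\<close> fixed, then over \<open>p\<close>.\<close>
  have "p \<le> arc_length \<gamma> a c - arc_length \<gamma> b c" if p: "p \<in> inscribed_lengths \<gamma> a b" for p
  proof -
    have "arc_length \<gamma> b c \<le> arc_length \<gamma> a c - p"
      unfolding arc_length_def[of _ b c] by (rule cSup_least[OF ne(2)]) (use *[OF p] in \<open>simp add: le_diff_eq add.commute\<close>)
    then show ?thesis by simp
  qed
  then have "arc_length \<gamma> a b \<le> arc_length \<gamma> a c - arc_length \<gamma> b c"
    unfolding arc_length_def[of _ a b] by (rule cSup_least[OF ne(1)])
  then show "arc_length \<gamma> a b + arc_length \<gamma> b c \<le> arc_length \<gamma> a c" by simp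
qed

section \<open>Length bounds for Lipschitz curves and contractions\<close>

lemma arc_length_le_lipschitz:
  fixes \<gamma> :: "real \<Rightarrow> 'a::metric_space"
  assumes lip: "\<And>s t. a \<le> s \<Longrightarrow> s \<le> t \<Longrightarrow> t \<le> b \<Longrightarrow> dist (\<gamma> s) (\<gamma> t) \<le> B * (t - s)" and "a \<le> b" "0 \<le> B"
  shows "bdd_above (inscribed_lengths \<gamma> a b)" "arc_length \<gamma> a b \<le> B * (b - a)"
proof -
  have *: "(\<Sum>i<m. dist (\<gamma> (t i)) (\<gamma> (t (Suc i)))) \<le> B * (b - a)"
    if t: "incseq t" "range t \<subseteq> {a..b}" for t m
  proof -
    have ab: "a \<le> t i" "t i \<le> b" for i using t(2) by (auto simp: image_subset_iff)
    have "(\<Sum>i<m. dist (\<gamma> (t i)) (\<gamma> (t (Suc i)))) \<le> (\<Sum>i<m. B * (t (Suc i) - t i))"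
      by (intro sum_mono lip ab incseq_SucD t)
    also have "\<dots> = B * (t m - t 0)"
      by (simp add: sum_distrib_left[symmetric] sum_lessThan_telescope)
    also have "\<dots> \<le> B * (b - a)"
      using ab[of m] ab[of 0] \<open>0 \<le> B\<close> by (intro mult_left_mono) auto
    finally show ?thesis .
  qed
  then show "bdd_above (inscribed_lengths \<gamma> a b)"
    by (intro bdd_aboveI[of _ "B * (b - a)"]) (auto simp: inscribed_lengths_def)
  show "arc_length \<gamma> a b \<le> B * (b - a)" using * \<open>a \<le> b\<close> by (intro arc_length_least)
qed

text \<open>Every inscribed polygon shrinks under \<open>P\<close>. This is applied to the
  projection onto a smaller ball, where the first claim makes the projected curve
  rectifiable.\<close>

lemma arc_length_contraction:
  fixes \<gamma> :: "real \<Rightarrow> 'a::metric_space" and P :: "'a \<Rightarrow> 'b::metric_space"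
  assumes P: "\<And>x y. dist (P x) (P y) \<le> dist x y" and "a \<le> b"
    and bdd: "bdd_above (inscribed_lengths \<gamma> a b)"
  shows "bdd_above (inscribed_lengths (P \<circ> \<gamma>) a b)" "arc_length (P \<circ> \<gamma>) a b \<le> arc_length \<gamma> a b"
proof -
  have *: "(\<Sum>i<m. dist ((P \<circ> \<gamma>) (t i)) ((P \<circ> \<gamma>) (t (Suc i)))) \<le> arc_length \<gamma> a b"
    if t: "incseq t" "range t \<subseteq> {a..b}" for t m
  proof -
    have "(\<Sum>i<m. dist ((P \<circ> \<gamma>) (t i)) ((P \<circ> \<gamma>) (t (Suc i)))) \<le>
        (\<Sum>i<m. dist (\<gamma> (t i)) (\<gamma> (t (Suc i))))"
      by (intro sum_mono) (simp add: P)
    also have "\<dots> \<le> arc_length \<gamma> a b" by (rule inscribed_length_le_arc_length[OF bdd t])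
    finally show ?thesis .
  qed
  then show "bdd_above (inscribed_lengths (P \<circ> \<gamma>) a b)"
    by (intro bdd_aboveI[of _ "arc_length \<gamma> a b"]) (auto simp: inscribed_lengths_def)
  show "arc_length (P \<circ> \<gamma>) a b \<le> arc_length \<gamma> a b" using * \<open>a \<le> b\<close> by (intro arc_length_least)
qed

section \<open>The arc length function of a rectifiable path\<close>

lemma rectifiable_path_bdd:
  assumes "rectifiable_path \<gamma>" "0 \<le> a" "b \<le> 1"
  shows "bdd_above (inscribed_lengths \<gamma> a b)"
  using assms bdd_above_mono[OF _ inscribed_lengths_mono, of \<gamma> 0 1 a b]
  by (simp add: rectifiable_path_def)

text \<open>Additivity turns increments of the integrator into lengths of subarcs, the form in which
  curves are compared and cells of Stieltjes sums are bounded.\<close>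

lemma arc_length_fun_diff:
  assumes "rectifiable_path \<gamma>" "0 \<le> s" "s \<le> t" "t \<le> 1"
  shows "arc_length_fun \<gamma> t - arc_length_fun \<gamma> s = arc_length \<gamma> s t"
  using arc_length_add[of 0 s t \<gamma>] rectifiable_path_bdd[OF assms(1), of 0 t] assms
  by (simp add: arc_length_fun_def arc_length_def)

lemma arc_length_fun_clamp: "arc_length_fun \<gamma> (max 0 (min 1 u)) = arc_length_fun \<gamma> u"
  by (simp add: arc_length_fun_def)

lemma dist_le_arc_length_fun:
  assumes "rectifiable_path \<gamma>" "0 \<le> s" "s \<le> t" "t \<le> 1"
  shows "dist (\<gamma> s) (\<gamma> t) \<le> arc_length_fun \<gamma> t - arc_length_fun \<gamma> s"
  unfolding arc_length_fun_diff[OF assms]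
  using assms by (intro dist_le_arc_length rectifiable_path_bdd)

lemma arc_length_fun_mono:
  assumes "rectifiable_path \<gamma>"
  shows "mono (arc_length_fun \<gamma>)"
proof
  fix s t :: real assume "s \<le> t"
  then have "max 0 (min 1 s) \<le> max 0 (min 1 t)" by (simp add: min_def max_def)
  then have "0 \<le> arc_length_fun \<gamma> (max 0 (min 1 t)) - arc_length_fun \<gamma> (max 0 (min 1 s))"
    by (intro order_trans[OF zero_le_dist dist_le_arc_length_fun] assms) auto
  then show "arc_length_fun \<gamma> s \<le> arc_length_fun \<gamma> t"
    unfolding arc_length_fun_clamp by simp
qed

text \<open>An inscribed polygon on \<open>{u..1}\<close> with almost full length is chosen first.
  With its finitely many nodes fixed, the part before \<open>v\<close> tends to 0 as
  \<open>v\<close> approaches \<open>u\<close>, by continuity of \<open>\<gamma>\<close>, so almost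
  all length lies after \<open>v\<close>.\<close>

lemma arc_length_small:
  fixes \<gamma> :: "real \<Rightarrow> 'a::metric_space"
  assumes \<gamma>: "rectifiable_path \<gamma>" and u: "0 \<le> u" "u < 1" and "e > 0"
  shows "\<exists>v>u. v \<le> 1 \<and> arc_length \<gamma> u v < e"
proof -
  have bdd: "bdd_above (inscribed_lengths \<gamma> a b)" if "0 \<le> a" "b \<le> 1" for a b
    using rectifiable_path_bdd[OF \<gamma> that] .
  have "\<exists>t m. incseq t \<and> range t \<subseteq> {u..1} \<and>
     arc_length \<gamma> u 1 - e / 2 < (\<Sum>i<m. dist (\<gamma> (t i)) (\<gamma> (t (Suc i))))"
  proof (rule ccontr)
    assume "\<nexists>t m. incseq t \<and> range t \<subseteq> {u..1} \<and>
     arc_length \<gamma> u 1 - e / 2 < (\<Sum>i<m. dist (\<gamma> (t i)) (\<gamma> (t (Suc i))))"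
    then have "arc_length \<gamma> u 1 \<le> arc_length \<gamma> u 1 - e / 2"
      using u by (intro arc_length_least) (auto simp: not_less)
    then show False using \<open>e > 0\<close> by simp
  qed
  then obtain t m where t: "incseq t" "range t \<subseteq> {u..1}"
    and lt: "arc_length \<gamma> u 1 - e / 2 < (\<Sum>i<m. dist (\<gamma> (t i)) (\<gamma> (t (Suc i))))" by blast
  have t_ge: "t i \<ge> u" "t i \<le> 1" for i using t(2) by (auto simp: image_subset_iff)
  have cont: "continuous_on {u..1} (\<lambda>v. \<gamma> (min (t i) v))" for i
    by (rule continuous_on_compose2[of "{0..1}" \<gamma>])
      (use \<gamma> u t_ge[of i] in \<open>auto simp: rectifiable_path_def path_def intro!: continuous_intros\<close>)
  have "continuous_on {u..1} (\<lambda>v. \<Sum>i<m. dist (\<gamma> (min (t i) v)) (\<gamma> (min (t (Suc i)) v)))"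
    by (intro continuous_intros cont)
  then have "((\<lambda>v. \<Sum>i<m. dist (\<gamma> (min (t i) v)) (\<gamma> (min (t (Suc i)) v))) \<longlongrightarrow>
      (\<Sum>i<m. dist (\<gamma> (min (t i) u)) (\<gamma> (min (t (Suc i)) u)))) (at u within {u..1})"
    using u by (auto simp: continuous_on_def)
  \<comment> \<open>All nodes are at least \<open>u\<close>, so truncation at \<open>u\<close>
    collapses them to the single point \<open>u\<close>.\<close>
  moreover have "(\<Sum>i<m. dist (\<gamma> (min (t i) u)) (\<gamma> (min (t (Suc i)) u))) = 0"
    using t_ge by (simp add: min_absorb2)
  ultimately have "\<forall>\<^sub>F v in at u within {u..1}. (\<Sum>i<m. dist (\<gamma> (min (t i) v)) (\<gamma> (min (t (Suc i)) v))) < e / 2"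
    using \<open>e > 0\<close> by (intro order_tendstoD(2)[where a="e/2"]) auto
  then obtain d where d: "d > 0"
    "\<And>v. v \<in> {u..1} \<Longrightarrow> v \<noteq> u \<Longrightarrow> dist v u < d \<Longrightarrow> (\<Sum>i<m. dist (\<gamma> (min (t i) v)) (\<gamma> (min (t (Suc i)) v))) < e / 2"
    unfolding eventually_at by blast
  define v where "v = min 1 (u + d / 2)"
  have v: "u < v" "v \<le> 1" "dist v u < d" using u d(1) by (auto simp: v_def dist_real_def min_def)
  have "(\<Sum>i<m. dist (\<gamma> (max (t i) v)) (\<gamma> (max (t (Suc i)) v))) \<le> arc_length \<gamma> v 1"
    using truncated_length_le_arc_length(2)[OF t, of v] bdd[of u 1] u v by auto
  \<comment> \<open>The polygon is split at \<open>v\<close>: its first part is below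
    \<open>e / 2\<close>, its second part is at most the length on \<open>{v..1}\<close>.\<close>
  then have "arc_length \<gamma> u 1 - e / 2 < e / 2 + arc_length \<gamma> v 1"
    using inscribed_length_split[OF t(1), of \<gamma> m v] lt d(2)[of v] v by auto
  moreover have "arc_length \<gamma> u 1 = arc_length \<gamma> u v + arc_length \<gamma> v 1"
    using u v by (intro arc_length_add bdd) auto
  ultimately show ?thesis using v by (intro exI[of _ v]) auto
qed

text \<open>For a monotone function it suffices to find, for each \<open>e\<close>, one
  \<open>v > u\<close> whose value exceeds that at \<open>u\<close> by less than \<open>e\<close>.
  If \<open>u < 0\<close> or \<open>1 \<le> u\<close> the function is constant just to the right of
  \<open>u\<close>; the remaining case is \<open>arc_length_small\<close>.\<close>

lemma arc_length_fun_right_continuous: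
  assumes \<gamma>: "rectifiable_path \<gamma>"
  shows "continuous (at_right u) (arc_length_fun \<gamma>)"
proof -
  have *: "\<exists>v>u. arc_length_fun \<gamma> v < arc_length_fun \<gamma> u + e" if e: "e > 0" for e
  proof -
    consider "u < 0" | "1 \<le> u" | "0 \<le> u" "u < 1" by linarith
    then show ?thesis
    proof cases
      case 1
      then show ?thesis using that by (intro exI[of _ 0]) (simp add: arc_length_fun_def)
    next
      case 2
      then show ?thesis using that by (intro exI[of _ "u + 1"]) (simp add: arc_length_fun_def)
    next
      case 3
      obtain v where v: "u < v" "v \<le> 1" "arc_length \<gamma> u v < e"
        using arc_length_small[OF \<gamma> 3 e] by blast
      then show ?thesis using arc_length_fun_diff[OF \<gamma>, of u v] 3 by (intro exI[of _ v]) auto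
    qed
  qed
  show ?thesis
    unfolding continuous_within
  proof (rule order_tendstoI)
    fix y assume "y < arc_length_fun \<gamma> u"
    then show "\<forall>\<^sub>F x in at_right u. y < arc_length_fun \<gamma> x"
      unfolding eventually_at_right_field
      by (intro exI[of _ "u + 1"]) (auto intro!: less_le_trans[where y = "arc_length_fun \<gamma> u"] monoD[OF arc_length_fun_mono[OF \<gamma>]])
  next
    fix y assume "arc_length_fun \<gamma> u < y"
    then obtain v where v: "v > u" "arc_length_fun \<gamma> v < y" using *[of "y - arc_length_fun \<gamma> u"] by auto
    then show "\<forall>\<^sub>F x in at_right u. arc_length_fun \<gamma> x < y"
      unfolding eventually_at_right_field
      by (intro exI[of _ v]) (auto intro!: le_less_trans[where y = "arc_length_fun \<gamma> v"] monoD[OF arc_length_fun_mono[OF \<gamma>]])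
  qed
qed

section \<open>Riemann-Stieltjes sums\<close>

text \<open>The parameter \<open>c\<close> places the tags: 0 gives left and 1 gives right end points.\<close>

definition stieltjes_sum :: "(real \<Rightarrow> real) \<Rightarrow> (real \<Rightarrow> real) \<Rightarrow> real \<Rightarrow> nat \<Rightarrow> real" where
  "stieltjes_sum f F c n = (\<Sum>i<n. f ((real i + c) / n) * (F (real (Suc i) / n) - F (real i / n)))"

context
  fixes F :: "real \<Rightarrow> real" and f :: "real \<Rightarrow> real"
  assumes mono_F: "mono F" and right_F: "\<And>u. continuous (at_right u) F"
    and cont_f: "continuous_on UNIV f"
begin

lemma interval_measure_Ioc:
  assumes "a \<le> b"
  shows "emeasure (interval_measure F) {a<..b} = ennreal (F b - F a)"
    "measure (interval_measure F) {a<..b} = F b - F a"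
  using emeasure_interval_measure_Ioc[of a b F] measure_interval_measure_Ioc[of a b F]
    assms monoD[OF mono_F] right_F by auto

lemma set_integrable_interval_measure: "set_integrable (interval_measure F) {a<..b} f"
proof (cases "a \<le> b")
  case True
  have "bounded (f ` {a..b})"
    by (intro compact_imp_bounded compact_continuous_image continuous_on_subset[OF cont_f]) auto
  then obtain B where B: "\<And>u. u \<in> {a..b} \<Longrightarrow> norm (f u) \<le> B"
    unfolding bounded_iff by blast
  have "f \<in> borel_measurable (interval_measure F)"
    unfolding measurable_cong_sets[OF sets_interval_measure refl]
    by (rule borel_measurable_continuous_onI[OF cont_f])
  then show ?thesis
    unfolding set_integrable_def
    by (intro integrableI_bounded_set_indicator[where B = B])
      (use B in \<open>auto simp: interval_measure_Ioc[OF True] intro!: AE_I2\<close>)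
qed (simp add: set_integrable_def)

lemma set_integral_interval_measure_approx:
  assumes "a \<le> b" and e: "\<And>u. a < u \<Longrightarrow> u \<le> b \<Longrightarrow> \<bar>f u - k\<bar> \<le> e"
  shows "\<bar>(LINT u:{a<..b}|interval_measure F. f u) - k * (F b - F a)\<bar> \<le> e * (F b - F a)"
proof -
  have const: "set_integrable (interval_measure F) {a<..b} (\<lambda>_. l)"
    "(LINT u:{a<..b}|interval_measure F. l) = l * (F b - F a)" for l :: real
    using interval_measure_Ioc[OF \<open>a \<le> b\<close>]
    by (auto simp: set_integrable_def set_lebesgue_integral_def)
  have "(LINT u:{a<..b}|interval_measure F. f u) \<le> (LINT u:{a<..b}|interval_measure F. k + e)"
    using e by (intro set_integral_mono const set_integrable_interval_measure) (force simp: abs_le_iff)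
  moreover have "(LINT u:{a<..b}|interval_measure F. k - e) \<le> (LINT u:{a<..b}|interval_measure F. f u)"
    using e by (intro set_integral_mono const set_integrable_interval_measure) (force simp: abs_le_iff)
  ultimately show ?thesis
    unfolding const by (simp add: abs_le_iff algebra_simps)
qed

text \<open>Uniform continuity bounds the error on each cell by \<open>e'\<close> times the
  increment of \<open>F\<close>, and these increments telescope. Every tag position in the cells
  gives the same limit; left and right tags are both used later.\<close>

lemma stieltjes_sum_tendsto:
  assumes c: "0 \<le> c" "c \<le> 1"
  shows "(\<lambda>n. stieltjes_sum f F c n) \<longlonglongrightarrow> (LINT u:{0<..1}|interval_measure F. f u)"
proof (rule LIMSEQ_I)
  fix e :: real assume "e > 0"
  \<comment> \<open>With the cumulative integral \<open>I\<close>, the integral over a cell is a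
    difference and the cells sum up by telescoping.\<close>
  define I where "I u = (LINT v:{0<..u}|interval_measure F. f v)" for u
  have I_diff: "I b - I a = (LINT v:{a<..b}|interval_measure F. f v)" if "0 \<le> a" "a \<le> b" for a b
  proof -
    have "{0<..b} = {0<..a} \<union> {a<..b}" using that by auto
    moreover have "{0<..a} \<inter> {a<..b} = {}" by auto
    ultimately show ?thesis
      unfolding I_def by (simp add: set_integral_Un set_integrable_interval_measure)
  qed
  have F01: "F 0 \<le> F 1" using monoD[OF mono_F] by simp
  \<comment> \<open>The added 1 keeps the denominator positive when \<open>F 0 = F 1\<close> and
    makes the total error strictly less than \<open>e\<close>.\<close>
  define e' where "e' = e / (F 1 - F 0 + 1)"
  have e': "e' > 0" "e' * (F 1 - F 0) < e"
    using \<open>e > 0\<close> F01 by (auto simp: e'_def field_simps)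
  have "uniformly_continuous_on {0..1} f"
    by (intro compact_uniformly_continuous continuous_on_subset[OF cont_f]) auto
  then obtain d where d: "d > 0"
    "\<And>u v. u \<in> {0..1} \<Longrightarrow> v \<in> {0..1} \<Longrightarrow> dist v u < d \<Longrightarrow> dist (f v) (f u) < e'"
    using e'(1) unfolding uniformly_continuous_on_def by metis
  obtain N where N: "N > 0" "1 / real N < d"
    using d(1) by (metis nat_approx_posE zero_less_Suc)
  show "\<exists>N. \<forall>n\<ge>N. norm (stieltjes_sum f F c n - (LINT u:{0<..1}|interval_measure F. f u)) < e"
  proof (intro exI allI impI)
    fix n assume n: "N \<le> n"
    have n0: "n > 0" "1 / real n < d"
    proof -
      show "n > 0" using N n by auto
      have "1 / real n \<le> 1 / real N" using N n by (intro divide_left_mono) auto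
      then show "1 / real n < d" using N by simp
    qed
    have step: "\<bar>(I (real (Suc i) / n) - I (real i / n)) - f ((real i + c) / n) * (F (real (Suc i) / n) - F (real i / n))\<bar>
        \<le> e' * (F (real (Suc i) / n) - F (real i / n))" if i: "i < n" for i
    proof -
      have le: "real i / n \<le> real (Suc i) / n" "0 \<le> real i / n" by (auto simp: divide_right_mono)
      show ?thesis
        unfolding I_diff[OF le(2,1)]
      proof (rule set_integral_interval_measure_approx[OF le(1)])
        fix u assume u: "real i / n < u" "u \<le> real (Suc i) / n"
        have tag: "real i / n \<le> (real i + c) / n" "(real i + c) / n \<le> real (Suc i) / n"
          using c by (auto intro!: divide_right_mono)
        have one: "real (Suc i) / n \<le> 1" using i by simp
        have width: "real (Suc i) / n - real i / n = 1 / n" by (simp add: diff_divide_distrib[symmetric])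
        have "dist u ((real i + c) / n) < d"
          using u tag n0 width by (auto simp: dist_real_def)
        moreover have "u \<in> {0..1}" "(real i + c) / n \<in> {0..1}"
          using u tag le(2) one unfolding atLeastAtMost_iff by linarith+
        ultimately have "dist (f u) (f ((real i + c) / n)) < e'"
          by (intro d(2))
        then show "\<bar>f u - f ((real i + c) / n)\<bar> \<le> e'" by (simp add: dist_real_def)
      qed
    qed
    have tele: "(\<Sum>i<n. G (real (Suc i) / n) - G (real i / n)) = G 1 - G 0" for G :: "real \<Rightarrow> real"
      using sum_lessThan_telescope[of "\<lambda>i. G (real i / n)" n] n0 by simp
    have "(I 1 - I 0) - stieltjes_sum f F c n =
        (\<Sum>i<n. (I (real (Suc i) / n) - I (real i / n)) - f ((real i + c) / n) * (F (real (Suc i) / n) - F (real i / n)))"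
      unfolding stieltjes_sum_def tele[of I, symmetric] by (rule sum_subtractf[symmetric])
    then have "\<bar>(I 1 - I 0) - stieltjes_sum f F c n\<bar>
        \<le> (\<Sum>i<n. e' * (F (real (Suc i) / n) - F (real i / n)))"
      using step by (auto intro!: order_trans[OF sum_abs] sum_mono)
    then have "\<bar>(I 1 - I 0) - stieltjes_sum f F c n\<bar> \<le> e' * (F 1 - F 0)"
      unfolding sum_distrib_left[symmetric] tele .
    moreover have "I 1 - I 0 = (LINT u:{0<..1}|interval_measure F. f u)"
      using I_diff[of 0 1] by simp
    ultimately show "norm (stieltjes_sum f F c n - (LINT u:{0<..1}|interval_measure F. f u)) < e"
      using e'(2) by (simp add: abs_minus_commute)
  qed
qed

end

section \<open>Arc length integrals as limits of Stieltjes sums\<close>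

lemma stieltjes_sum_tendsto_arc_length_integral:
  fixes \<gamma> :: "real \<Rightarrow> 'a::metric_space" and w :: "'a \<Rightarrow> real"
  assumes \<gamma>: "rectifiable_path \<gamma>" and w: "continuous_on (path_image \<gamma>) w" and c: "0 \<le> c" "c \<le> 1"
  shows "(\<lambda>n. stieltjes_sum (\<lambda>u. w (\<gamma> u)) (arc_length_fun \<gamma>) c n) \<longlonglongrightarrow> arc_length_integral \<gamma> w"
proof -
  define F where "F = arc_length_fun \<gamma>"
  \<comment> \<open>Clamping the parameter extends \<open>w (\<gamma> u)\<close> continuously from
    \<open>{0..1}\<close> to the whole line.\<close>
  define f where "f u = w (\<gamma> (max 0 (min 1 u)))" for u
  have F: "mono F" "\<And>u. continuous (at_right u) F"
    unfolding F_def using \<gamma> by (rule arc_length_fun_mono, rule arc_length_fun_right_continuous)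
  have "continuous_on {0..1} (\<lambda>u. w (\<gamma> u))"
    using \<gamma> w by (intro continuous_on_compose2[OF w]) (auto simp: rectifiable_path_def path_def path_image_def)
  then have f: "continuous_on UNIV f"
    unfolding f_def by (rule continuous_on_compose2) (auto intro!: continuous_intros)
  have "stieltjes_sum (\<lambda>u. w (\<gamma> u)) F c n = stieltjes_sum f F c n" for n
    unfolding stieltjes_sum_def
  proof (intro sum.cong refl arg_cong2[where f = "(*)"])
    fix i assume "i \<in> {..<n}"
    then have "(real i + c) / n \<le> 1" using c by (auto simp: divide_simps)
    then show "w (\<gamma> ((real i + c) / n)) = f ((real i + c) / n)" using c by (simp add: f_def)
  qed
  moreover have "arc_length_integral \<gamma> w = (LINT u:{0<..1}|interval_measure F. f u)"
  proof -
    \<comment> \<open>The integral is defined over \<open>{0..1}\<close>, while the sums converge to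
      the one over \<open>{0<..1}\<close>. The arc length function is constant to the left of 0, so
      the point 0 carries no mass.\<close>
    have "emeasure (interval_measure F) {-1<..0} = 0"
      using interval_measure_Ioc(1)[OF F f, of "-1" 0] by (simp add: F_def arc_length_fun_def)
    then have "AE u in interval_measure F. u \<notin> {-1<..0}"
      by (intro AE_I[where N = "{-1<..0}"]) auto
    then have "AE u in interval_measure F.
        indicator {0..1} u *\<^sub>R w (\<gamma> u) = indicator {0<..1} u *\<^sub>R f u"
      by eventually_elim (auto simp: f_def indicator_def)
    moreover have "(\<lambda>u. indicator {0..1} u *\<^sub>R w (\<gamma> u)) \<in> borel_measurable borel"
    proof -
      have "(\<lambda>u. indicator {0..1} u *\<^sub>R w (\<gamma> u)) = (\<lambda>u. indicator {0..1} u *\<^sub>R f u)"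
        by (auto simp: f_def indicator_def)
      then show ?thesis using borel_measurable_continuous_onI[OF f] by simp
    qed
    moreover have "(\<lambda>u. indicator {0<..1} u *\<^sub>R f u) \<in> borel_measurable borel"
      using borel_measurable_continuous_onI[OF f] by simp
    ultimately show ?thesis
      unfolding arc_length_integral_def set_lebesgue_integral_def F_def[symmetric]
      by (intro integral_cong_AE) simp_all
  qed
  ultimately show ?thesis
    using stieltjes_sum_tendsto[OF F f c] by (simp add: F_def)
qed

text \<open>The two curves have different arc length measures, so the integrals are compared through
  their Stieltjes sums, where each cell has both a smaller value and a smaller increment.\<close>

lemma arc_length_integral_mono:
  fixes \<gamma> :: "real \<Rightarrow> 'a::metric_space" and \<delta> :: "real \<Rightarrow> 'b::metric_space"
  assumes \<gamma>: "rectifiable_path \<gamma>" "continuous_on (path_image \<gamma>) w"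
    and \<delta>: "rectifiable_path \<delta>" "continuous_on (path_image \<delta>) v"
    and len: "\<And>s t. 0 \<le> s \<Longrightarrow> s \<le> t \<Longrightarrow> t \<le> 1 \<Longrightarrow> arc_length \<delta> s t \<le> arc_length \<gamma> s t"
    and le: "\<And>u. 0 \<le> u \<Longrightarrow> u \<le> 1 \<Longrightarrow> 0 \<le> v (\<delta> u) \<and> v (\<delta> u) \<le> w (\<gamma> u)"
  shows "arc_length_integral \<delta> v \<le> arc_length_integral \<gamma> w"
proof (rule LIMSEQ_le)
  show "(\<lambda>n. stieltjes_sum (\<lambda>u. w (\<gamma> u)) (arc_length_fun \<gamma>) 0 n) \<longlonglongrightarrow> arc_length_integral \<gamma> w"
    "(\<lambda>n. stieltjes_sum (\<lambda>u. v (\<delta> u)) (arc_length_fun \<delta>) 0 n) \<longlonglongrightarrow> arc_length_integral \<delta> v"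
    using \<gamma> \<delta> by (auto intro: stieltjes_sum_tendsto_arc_length_integral)
  have "stieltjes_sum (\<lambda>u. v (\<delta> u)) (arc_length_fun \<delta>) 0 n \<le> stieltjes_sum (\<lambda>u. w (\<gamma> u)) (arc_length_fun \<gamma>) 0 n" for n
    unfolding stieltjes_sum_def
  proof (rule sum_mono)
    fix i assume "i \<in> {..<n}"
    then have i: "0 \<le> real i / n" "real i / n \<le> real (Suc i) / n" "real (Suc i) / n \<le> 1"
      by (auto simp: divide_simps)
    have *: "v (\<delta> (real i / n)) \<ge> 0" "v (\<delta> (real i / n)) \<le> w (\<gamma> (real i / n))"
      using le[of "real i / n"] i by auto
    have "0 \<le> arc_length_fun \<delta> (real (Suc i) / n) - arc_length_fun \<delta> (real i / n)"
      using dist_le_arc_length_fun[OF \<delta>(1) i] zero_le_dist order_trans by blast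
    moreover have "arc_length_fun \<delta> (real (Suc i) / n) - arc_length_fun \<delta> (real i / n)
        \<le> arc_length_fun \<gamma> (real (Suc i) / n) - arc_length_fun \<gamma> (real i / n)"
      unfolding arc_length_fun_diff[OF \<delta>(1) i] arc_length_fun_diff[OF \<gamma>(1) i] using i by (rule len)
    ultimately show "v (\<delta> ((real i + 0) / n)) * (arc_length_fun \<delta> (real (Suc i) / n) - arc_length_fun \<delta> (real i / n))
        \<le> w (\<gamma> ((real i + 0) / n)) * (arc_length_fun \<gamma> (real (Suc i) / n) - arc_length_fun \<gamma> (real i / n))"
      using * by (intro mult_mono) auto
  qed
  then show "\<exists>N. \<forall>n\<ge>N. stieltjes_sum (\<lambda>u. v (\<delta> u)) (arc_length_fun \<delta>) 0 n
      \<le> stieltjes_sum (\<lambda>u. w (\<gamma> u)) (arc_length_fun \<gamma>) 0 n" by blast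
qed

lemma arc_length_integral_nonneg:
  assumes "\<And>z. z \<in> path_image \<gamma> \<Longrightarrow> 0 \<le> w z"
  shows "0 \<le> arc_length_integral \<gamma> w"
  unfolding arc_length_integral_def set_lebesgue_integral_def
  using assms by (intro integral_nonneg_AE AE_I2) (auto simp: path_image_def indicator_def)

lemma arc_length_integral_cmult:
  "arc_length_integral \<gamma> (\<lambda>z. k * w z) = k * arc_length_integral \<gamma> w"
  by (simp add: arc_length_integral_def)

section \<open>Lower and upper estimates of arc length integrals\<close>

text \<open>By \<open>ln b - ln a \<le> (b - a) / a\<close>, each summand dominates an increment of
  a logarithm, and these telescope. The tag must sit where the argument of the logarithm is smaller:
  at the left end when it grows with \<open>F u\<close>, at the right end when it decreases.\<close>

lemma stieltjes_sum_inverse_ge_ln: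
  fixes F f :: "real \<Rightarrow> real"
  assumes "mono F" "0 < d" "0 < n"
  shows "(\<And>u. 0 \<le> u \<Longrightarrow> u \<le> 1 \<Longrightarrow> 1 / (d + F u - F 0) \<le> f u)
      \<Longrightarrow> ln (1 + (F 1 - F 0) / d) \<le> stieltjes_sum f F 0 n"
    and "(\<And>u. 0 \<le> u \<Longrightarrow> u \<le> 1 \<Longrightarrow> 1 / (d + F 1 - F u) \<le> f u)
      \<Longrightarrow> ln (1 + (F 1 - F 0) / d) \<le> stieltjes_sum f F 1 n"
proof -
  have tele: "(\<Sum>i<n. G (real (Suc i) / n) - G (real i / n)) = G 1 - G 0" for G :: "real \<Rightarrow> real"
    using sum_lessThan_telescope[of "\<lambda>i. G (real i / n)" n] assms(3) by simp
  have F01: "F 0 \<le> F 1" using monoD[OF assms(1)] by simp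
  have ln_eq: "ln (1 + (F 1 - F 0) / d) = ln (d + F 1 - F 0) - ln d"
    using assms(2) F01 by (subst ln_divide_pos[symmetric]) (auto simp: field_simps)
  have i: "0 \<le> real i / n" "real i / n \<le> real (Suc i) / n" "real (Suc i) / n \<le> 1" "real i / n \<le> 1" if "i < n" for i
    using that by (auto simp: divide_simps)
  have F: "F 0 \<le> F (real i / n)" "F (real i / n) \<le> F (real (Suc i) / n)" "F (real (Suc i) / n) \<le> F 1" if "i < n" for i
    using monoD[OF assms(1)] i[OF that] by auto
  {
    assume f: "\<And>u. 0 \<le> u \<Longrightarrow> u \<le> 1 \<Longrightarrow> 1 / (d + F u - F 0) \<le> f u"
    have "ln (1 + (F 1 - F 0) / d) = (\<Sum>i<n. ln (d + F (real (Suc i) / n) - F 0) - ln (d + F (real i / n) - F 0))"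
      unfolding tele[of "\<lambda>u. ln (d + F u - F 0)"] ln_eq by simp
    also have "\<dots> \<le> stieltjes_sum f F 0 n"
      unfolding stieltjes_sum_def
    proof (rule sum_mono)
      fix j assume "j \<in> {..<n}"
      then have j: "j < n" by simp
      have "ln (d + F (real (Suc j) / n) - F 0) - ln (d + F (real j / n) - F 0) \<le>
          (d + F (real (Suc j) / n) - F 0 - (d + F (real j / n) - F 0)) / (d + F (real j / n) - F 0)"
        using F[OF j] assms(2) by (intro ln_diff_le) auto
      also have "\<dots> = 1 / (d + F (real j / n) - F 0) * (F (real (Suc j) / n) - F (real j / n))" by simp
      also have "\<dots> \<le> f (real j / n) * (F (real (Suc j) / n) - F (real j / n))"
        using F[OF j] i[OF j] by (intro mult_right_mono f) auto
      finally show "ln (d + F (real (Suc j) / n) - F 0) - ln (d + F (real j / n) - F 0) \<le>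
          f ((real j + 0) / n) * (F (real (Suc j) / n) - F (real j / n))" by simp
    qed
    finally show "ln (1 + (F 1 - F 0) / d) \<le> stieltjes_sum f F 0 n" .
  next
    assume f: "\<And>u. 0 \<le> u \<Longrightarrow> u \<le> 1 \<Longrightarrow> 1 / (d + F 1 - F u) \<le> f u"
    have "ln (1 + (F 1 - F 0) / d) = (\<Sum>i<n. (- ln (d + F 1 - F (real (Suc i) / n))) - (- ln (d + F 1 - F (real i / n))))"
      unfolding tele[of "\<lambda>u. - ln (d + F 1 - F u)"] ln_eq by simp
    also have "\<dots> \<le> stieltjes_sum f F 1 n"
      unfolding stieltjes_sum_def
    proof (rule sum_mono)
      fix j assume "j \<in> {..<n}"
      then have j: "j < n" by simp
      have "ln (d + F 1 - F (real j / n)) - ln (d + F 1 - F (real (Suc j) / n)) \<le>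
          (d + F 1 - F (real j / n) - (d + F 1 - F (real (Suc j) / n))) / (d + F 1 - F (real (Suc j) / n))"
        using F[OF j] assms(2) by (intro ln_diff_le) auto
      also have "\<dots> = 1 / (d + F 1 - F (real (Suc j) / n)) * (F (real (Suc j) / n) - F (real j / n))" by simp
      also have "\<dots> \<le> f (real (Suc j) / n) * (F (real (Suc j) / n) - F (real j / n))"
        using F[OF j] i[OF j] by (intro mult_right_mono f) auto
      finally show "- ln (d + F 1 - F (real (Suc j) / n)) - - ln (d + F 1 - F (real j / n)) \<le>
          f ((real j + 1) / n) * (F (real (Suc j) / n) - F (real j / n))" by (simp add: add.commute)
    qed
    finally show "ln (1 + (F 1 - F 0) / d) \<le> stieltjes_sum f F 1 n" .
  }
qed

text \<open>On a short cell the length is at most the maximal speed times the width, and the density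
  hardly varies, so each cell contributes at most about \<open>D\<close> times its width. A uniform
  bound \<open>D\<close> is enough for geodesics, whose hyperbolic speed is constant.\<close>

lemma arc_length_integral_le_of_derivative:
  fixes \<gamma> :: "real \<Rightarrow> 'a::euclidean_space"
  assumes deriv: "\<And>t. t \<in> {0..1} \<Longrightarrow> (\<gamma> has_vector_derivative \<gamma>' t) (at t within {0..1})"
    and g: "continuous_on {0..1} g" "\<And>t. t \<in> {0..1} \<Longrightarrow> norm (\<gamma>' t) \<le> g t"
    and w: "continuous_on (path_image \<gamma>) w" "\<And>z. z \<in> path_image \<gamma> \<Longrightarrow> 0 \<le> w z"
    and D: "\<And>t. t \<in> {0..1} \<Longrightarrow> w (\<gamma> t) * g t \<le> D"
  shows "rectifiable_path \<gamma>" "arc_length_integral \<gamma> w \<le> D"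
proof -
  have cont: "continuous_on {0..1} \<gamma>"
    by (rule continuous_on_vector_derivative[OF deriv])
  \<comment> \<open>The mean value inequality is kept general in the interval and in
    \<open>B\<close>: it is used globally with the maximum of \<open>g\<close> and on single cells
    with the local maximum.\<close>
  have lip: "dist (\<gamma> s) (\<gamma> t) \<le> B * (t - s)"
    if ab: "0 \<le> a" "b \<le> 1" and st: "a \<le> s" "s \<le> t" "t \<le> b" and B: "\<And>u. u \<in> {a..b} \<Longrightarrow> g u \<le> B" for a b s t B
  proof -
    have "norm (\<gamma> t - \<gamma> s) \<le> B * norm (t - s)"
    proof (rule differentiable_bound[where S = "{a..b}" and f' = "\<lambda>u h. h *\<^sub>R \<gamma>' u"])
      fix u assume u: "u \<in> {a..b}"
      show "(\<gamma> has_derivative (\<lambda>h. h *\<^sub>R \<gamma>' u)) (at u within {a..b})"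
        using deriv[of u] u ab unfolding has_vector_derivative_def[symmetric]
        by (auto intro: has_vector_derivative_within_subset)
      show "onorm (\<lambda>h. h *\<^sub>R \<gamma>' u) \<le> B"
        using order_trans[OF g(2)[of u] B[OF u]] u ab
        by (intro onorm_le) (simp add: mult.commute[of _ "norm (\<gamma>' u)"] mult_right_mono)
    qed (use st in auto)
    then show ?thesis using st by (simp add: dist_norm norm_minus_commute)
  qed
  obtain G where G: "\<And>u. u \<in> {0..1} \<Longrightarrow> g u \<le> G" "0 \<le> G"
  proof -
    obtain v where "v \<in> {0..1}" "\<And>u. u \<in> {0..1} \<Longrightarrow> g u \<le> g v"
      using continuous_attains_sup[of "{0..1::real}" g] g(1) by auto
    then show ?thesis using that[of "g v"] g(2)[of v] norm_ge_zero[of "\<gamma>' v"] by fastforce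
  qed
  show rect: "rectifiable_path \<gamma>"
    unfolding rectifiable_path_def path_def
    using cont arc_length_le_lipschitz(1)[of 0 1 \<gamma> G] lip[of 0 1 _ _ G] G by auto
  have w\<gamma>: "continuous_on {0..1} (\<lambda>u. w (\<gamma> u))"
    by (intro continuous_on_compose2[OF w(1) cont]) (auto simp: path_image_def)
  have "arc_length_integral \<gamma> w \<le> D + e" if "e > 0" for e
  proof -
    define e' where "e' = e / (G + 1)"
    have e': "e' > 0" "e' * G \<le> e" using \<open>e > 0\<close> G(2) by (auto simp: e'_def field_simps)
    have "uniformly_continuous_on {0..1} (\<lambda>u. w (\<gamma> u))"
      by (intro compact_uniformly_continuous w\<gamma>) auto
    then obtain d where d: "d > 0"
      "\<And>u v. u \<in> {0..1} \<Longrightarrow> v \<in> {0..1} \<Longrightarrow> dist v u < d \<Longrightarrow> dist (w (\<gamma> v)) (w (\<gamma> u)) < e'"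
      using e'(1) unfolding uniformly_continuous_on_def by metis
    obtain N where N: "N > 0" "1 / real N < d"
      using d(1) by (metis nat_approx_posE zero_less_Suc)
    have "stieltjes_sum (\<lambda>u. w (\<gamma> u)) (arc_length_fun \<gamma>) 0 n \<le> D + e" if n: "N \<le> n" for n
    proof -
      have n0: "n > 0" "1 / real n < d"
      proof -
        show "n > 0" using N n by auto
        have "1 / real n \<le> 1 / real N" using N n by (intro divide_left_mono) auto
        then show "1 / real n < d" using N by simp
      qed
      have "stieltjes_sum (\<lambda>u. w (\<gamma> u)) (arc_length_fun \<gamma>) 0 n \<le> (\<Sum>i<n. (D + e) / n)"
        unfolding stieltjes_sum_def
      proof (rule sum_mono)
        fix i assume "i \<in> {..<n}"
        define s where "s = real i / n"
        define t where "t = real (Suc i) / n"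
        have st: "0 \<le> s" "s \<le> t" "t \<le> 1" "t - s = 1 / n"
          using \<open>i \<in> {..<n}\<close> by (auto simp: s_def t_def divide_simps)
        \<comment> \<open>The speed bound peaks at \<open>v\<close>, which makes \<open>g v\<close>
          a Lipschitz constant on the cell.\<close>
        obtain v where v: "v \<in> {s..t}" "\<And>u. u \<in> {s..t} \<Longrightarrow> g u \<le> g v"
          using continuous_attains_sup[of "{s..t}" g] continuous_on_subset[OF g(1), of "{s..t}"] st by auto
        have v01: "v \<in> {0..1}" using v(1) st by auto
        have gv: "0 \<le> g v" "g v \<le> G" using g(2)[OF v01] norm_ge_zero[of "\<gamma>' v"] G(1)[OF v01] by linarith+
        have "arc_length_fun \<gamma> t - arc_length_fun \<gamma> s \<le> g v * (1 / n)"
          unfolding arc_length_fun_diff[OF rect st(1-3)] st(4)[symmetric]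
          using arc_length_le_lipschitz(2)[of s t \<gamma> "g v"] lip[of s t _ _ "g v"] v(2) st gv by auto
        moreover have w_nonneg: "0 \<le> w (\<gamma> s)" using w(2) st by (auto simp: path_image_def)
        ultimately have "w (\<gamma> s) * (arc_length_fun \<gamma> t - arc_length_fun \<gamma> s) \<le> w (\<gamma> s) * (g v * (1 / n))"
          by (intro mult_left_mono)
        also have "\<dots> = (w (\<gamma> s) * g v) / n" by simp
        also have "\<dots> \<le> (D + e) / n"
        proof (rule divide_right_mono)
          \<comment> \<open>The density is moved from the tag \<open>s\<close> to \<open>v\<close>,
            at the cost of \<open>e'\<close>, because \<open>D\<close> bounds the product of density
            and speed only at a common point.\<close>
          have "dist v s < d" using v(1) st n0 by (auto simp: dist_real_def)
          then have "w (\<gamma> s) \<le> w (\<gamma> v) + e'" using d(2)[of s v] v01 st by (auto simp: dist_real_def)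
          then have "w (\<gamma> s) * g v \<le> (w (\<gamma> v) + e') * g v" using gv by (intro mult_right_mono)
          also have "\<dots> \<le> D + e' * G"
            using D[OF v01] gv e'(1) by (auto simp: distrib_right intro!: add_mono)
          finally show "w (\<gamma> s) * g v \<le> D + e" using e'(2) by simp
        qed simp
        finally show "w (\<gamma> ((real i + 0) / n)) * (arc_length_fun \<gamma> (real (Suc i) / n) - arc_length_fun \<gamma> (real i / n))
            \<le> (D + e) / n" by (simp add: s_def t_def)
      qed
      then show ?thesis using n0 by simp
    qed
    moreover have "(\<lambda>n. stieltjes_sum (\<lambda>u. w (\<gamma> u)) (arc_length_fun \<gamma>) 0 n) \<longlonglongrightarrow> arc_length_integral \<gamma> w"
      using rect w(1) by (rule stieltjes_sum_tendsto_arc_length_integral) auto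
    ultimately show ?thesis by (intro LIMSEQ_le_const2) blast+
  qed
  then show "arc_length_integral \<gamma> w \<le> D" by (rule field_le_epsilon)
qed

section \<open>Metrics of the unit ball\<close>

abbreviation hyperbolic_density :: "'a::euclidean_space \<Rightarrow> real" where
  "hyperbolic_density \<equiv> \<lambda>z. 2 / (1 - (norm z)\<^sup>2)"

abbreviation quasihyperbolic_density :: "'a::euclidean_space \<Rightarrow> real" where
  "quasihyperbolic_density \<equiv> \<lambda>z. 1 / (1 - norm z)"

lemma norm_power2_less_1: "norm (z :: 'a::euclidean_space) < 1 \<Longrightarrow> (norm z)\<^sup>2 < 1"
  by (simp add: power_less_one_iff abs_square_less_1)

lemma continuous_on_densities:
  assumes "S \<subseteq> ball (0::'a::euclidean_space) 1"
  shows "continuous_on S hyperbolic_density" "continuous_on S quasihyperbolic_density"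
proof -
  have "norm z < 1" if "z \<in> S" for z
    using assms that by auto
  moreover from this have "(norm z)\<^sup>2 < 1" if "z \<in> S" for z
    using norm_power2_less_1 that by blast
  ultimately show "continuous_on S hyperbolic_density" "continuous_on S quasihyperbolic_density"
    by (fastforce intro!: continuous_intros)+
qed

lemma densities_nonneg:
  assumes "z \<in> ball (0::'a::euclidean_space) 1"
  shows "0 \<le> hyperbolic_density z" "0 \<le> quasihyperbolic_density z"
  using assms norm_power2_less_1[of z] by auto

section \<open>Geodesics in the hyperboloid model\<close>

text \<open>The point \<open>z\<close> of the ball corresponds to the point \<open>(X, V)\<close> of the hyperboloid
  \<open>X\<^sup>2 - |V|\<^sup>2 = 1\<close> with \<open>X = (1 + |z|\<^sup>2) / (1 - |z|\<^sup>2)\<close> and \<open>V = 2 z / (1 - |z|\<^sup>2)\<close>, so \<open>z = V / (1 + X)\<close>.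
  The pair \<open>(w, W)\<close> is a unit tangent vector at \<open>(X, V)\<close> for the Minkowski form.\<close>

context
  fixes V W :: "'a::euclidean_space" and X w D :: real
  assumes VV: "V \<bullet> V = X\<^sup>2 - 1" and VW: "V \<bullet> W = X * w" and WW: "W \<bullet> W = w\<^sup>2 + 1"
    and X: "1 \<le> X" and D: "0 \<le> D"
begin

text \<open>Together with \<open>geodesic_time\<close> this is the hyperbola
  \<open>cosh (D * t)\<close> times \<open>(X, V)\<close> plus \<open>sinh (D * t)\<close> times
  \<open>(w, W)\<close>. The factor \<open>D\<close> scales time so that \<open>{0..1}\<close>
  covers hyperbolic length \<open>D\<close>, and \<open>geodesic\<close> is the stereographic
  projection of the hyperbola to the ball.\<close>

definition geodesic_space :: "real \<Rightarrow> 'a" where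
  "geodesic_space t = cosh (D * t) *\<^sub>R V + sinh (D * t) *\<^sub>R W"

definition geodesic_time :: "real \<Rightarrow> real" where
  "geodesic_time t = cosh (D * t) * X + sinh (D * t) * w"

definition geodesic :: "real \<Rightarrow> 'a" where
  "geodesic t = (1 / (1 + geodesic_time t)) *\<^sub>R geodesic_space t"

lemma geodesic_space_norm: "geodesic_space t \<bullet> geodesic_space t = (geodesic_time t)\<^sup>2 - 1"
proof -
  have "geodesic_space t \<bullet> geodesic_space t =
      (cosh (D * t))\<^sup>2 * (X\<^sup>2 - 1) + 2 * cosh (D * t) * sinh (D * t) * (X * w) + (sinh (D * t))\<^sup>2 * (w\<^sup>2 + 1)"
    unfolding VV[symmetric] VW[symmetric] WW[symmetric] geodesic_space_def
    by (simp add: inner_add_left inner_add_right inner_commute power2_eq_square algebra_simps)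
  also have "\<dots> = (geodesic_time t)\<^sup>2 - 1"
    unfolding geodesic_time_def using cosh_square_eq[of "D * t"] by algebra
  finally show ?thesis .
qed

text \<open>The curve stays on the upper sheet: Cauchy-Schwarz for \<open>V\<close> and
  \<open>W\<close> gives \<open>\<bar>w\<bar> < X\<close>, which with
  \<open>\<bar>sinh\<bar> < cosh\<close> makes the time coordinate positive, and on the hyperboloid
  its square is at least 1.\<close>

lemma geodesic_time_ge_1: "1 \<le> geodesic_time t"
proof -
  have "(X * w)\<^sup>2 \<le> (X\<^sup>2 - 1) * (w\<^sup>2 + 1)"
    using Cauchy_Schwarz_ineq[of V W] unfolding VV VW WW .
  then have "w\<^sup>2 < X\<^sup>2" by (simp add: algebra_simps)
  then have "\<bar>w\<bar> < X" using power2_less_imp_less[of "\<bar>w\<bar>" X] X by simp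
  have "\<bar>sinh (D * t)\<bar> < cosh (D * t)"
    using power2_less_imp_less[of "\<bar>sinh (D * t)\<bar>" "cosh (D * t)"] cosh_square_eq[of "D * t"] by simp
  then have "\<bar>sinh (D * t) * w\<bar> < cosh (D * t) * X"
    unfolding abs_mult using \<open>\<bar>w\<bar> < X\<close> by (rule mult_strict_mono') auto
  then have "0 < geodesic_time t" unfolding geodesic_time_def by linarith
  moreover have "1 \<le> (geodesic_time t)\<^sup>2"
    using geodesic_space_norm[of t] inner_ge_zero[of "geodesic_space t"] by linarith
  ultimately show ?thesis using power2_le_imp_le[of 1 "geodesic_time t"] by simp
qed

lemma geodesic_density:
  shows "1 - (norm (geodesic t))\<^sup>2 = 2 / (1 + geodesic_time t)"
    and "geodesic t \<in> ball 0 1"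
    and "hyperbolic_density (geodesic t) = 1 + geodesic_time t"
proof -
  have pos: "1 + geodesic_time t > 0" using geodesic_time_ge_1[of t] by simp
  have "(norm (geodesic t))\<^sup>2 = ((geodesic_time t)\<^sup>2 - 1) / (1 + geodesic_time t)\<^sup>2"
    unfolding power2_norm_eq_inner geodesic_def
    by (simp add: geodesic_space_norm power2_eq_square)
  also have "\<dots> = (geodesic_time t - 1) / (1 + geodesic_time t)"
    using pos by (simp add: frac_eq_eq) (simp add: power2_eq_square algebra_simps)
  finally show *: "1 - (norm (geodesic t))\<^sup>2 = 2 / (1 + geodesic_time t)"
    using pos by (simp add: field_simps)
  then have "(norm (geodesic t))\<^sup>2 < 1\<^sup>2"
    using pos by (smt (verit) divide_pos_pos one_power2)
  then show "geodesic t \<in> ball 0 1" by (simp add: power_less_imp_less_base)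
  show "hyperbolic_density (geodesic t) = 1 + geodesic_time t" unfolding * using pos by simp
qed

text \<open>The velocity \<open>(X', V')\<close> on the hyperboloid has Minkowski square
  \<open>D^2\<close> and is Minkowski orthogonal to the position. Stereographic projection is
  conformal with factor \<open>1 / (1 + geodesic_time t)\<close>, the reciprocal of the hyperbolic
  density.\<close>

lemma geodesic_has_vector_derivative:
  "\<exists>\<gamma>'. (geodesic has_vector_derivative \<gamma>') (at t within S) \<and> norm \<gamma>' = D / (1 + geodesic_time t)"
proof -
  define q where "q = 1 / (1 + geodesic_time t)"
  define X' where "X' = D * (sinh (D * t) * X + cosh (D * t) * w)"
  define V' where "V' = D *\<^sub>R (sinh (D * t) *\<^sub>R V + cosh (D * t) *\<^sub>R W)"
  have pos: "1 + geodesic_time t > 0" using geodesic_time_ge_1[of t] by simp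
  have dX: "(geodesic_time has_field_derivative X') (at t within S)"
    unfolding geodesic_time_def[abs_def] X'_def
    by (auto intro!: derivative_eq_intros simp: algebra_simps)
  have dV: "(geodesic_space has_vector_derivative V') (at t within S)"
  proof -
    have "((\<lambda>t. cosh (D * t)) has_field_derivative (D * sinh (D * t))) (at t within S)"
      "((\<lambda>t. sinh (D * t)) has_field_derivative (D * cosh (D * t))) (at t within S)"
      by (auto intro!: derivative_eq_intros)
    from has_vector_derivative_add[OF has_vector_derivative_scaleR[OF this(1) has_vector_derivative_const[of V]]
        has_vector_derivative_scaleR[OF this(2) has_vector_derivative_const[of W]]]
    show ?thesis unfolding geodesic_space_def[abs_def] V'_def by (simp add: scaleR_add_right)
  qed
  have dq: "((\<lambda>t. 1 / (1 + geodesic_time t)) has_field_derivative (- X' * q\<^sup>2)) (at t within S)"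
    unfolding q_def using pos
    by (auto intro!: derivative_eq_intros dX simp: field_simps power2_eq_square)
  have d: "(geodesic has_vector_derivative (q *\<^sub>R V' + (- X' * q\<^sup>2) *\<^sub>R geodesic_space t)) (at t within S)"
    unfolding geodesic_def[abs_def] q_def
    using has_vector_derivative_scaleR[OF dq dV] by (simp add: q_def)
  have cs: "(cosh (D * t))\<^sup>2 = (sinh (D * t))\<^sup>2 + 1" by (rule cosh_square_eq)
  have "V' \<bullet> V' = D\<^sup>2 * ((sinh (D * t))\<^sup>2 * (X\<^sup>2 - 1) + 2 * cosh (D * t) * sinh (D * t) * (X * w) + (cosh (D * t))\<^sup>2 * (w\<^sup>2 + 1))"
    unfolding VV[symmetric] VW[symmetric] WW[symmetric] V'_def
    by (simp add: inner_add_left inner_add_right inner_commute power2_eq_square algebra_simps)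
  also have "\<dots> = D\<^sup>2 + X'\<^sup>2" unfolding X'_def using cs by algebra
  finally have V'V': "V' \<bullet> V' = D\<^sup>2 + X'\<^sup>2" .
  have "V' \<bullet> geodesic_space t = D * (sinh (D * t) * cosh (D * t) * (X\<^sup>2 - 1)
      + ((cosh (D * t))\<^sup>2 + (sinh (D * t))\<^sup>2) * (X * w) + sinh (D * t) * cosh (D * t) * (w\<^sup>2 + 1))"
    unfolding VV[symmetric] VW[symmetric] WW[symmetric] V'_def geodesic_space_def
    by (simp add: inner_add_left inner_add_right inner_commute power2_eq_square algebra_simps)
  also have "\<dots> = X' * geodesic_time t" unfolding X'_def geodesic_time_def using cs by algebra
  finally have V'V: "V' \<bullet> geodesic_space t = X' * geodesic_time t" .
  have q: "q * (1 + geodesic_time t) = 1" using pos by (simp add: q_def)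
  have "(norm (q *\<^sub>R V' + (- X' * q\<^sup>2) *\<^sub>R geodesic_space t))\<^sup>2
      = q\<^sup>2 * (V' \<bullet> V') - 2 * X' * q^3 * (V' \<bullet> geodesic_space t) + X'\<^sup>2 * q^4 * (geodesic_space t \<bullet> geodesic_space t)"
    unfolding power2_norm_eq_inner
    by (simp add: inner_add_left inner_add_right inner_commute algebra_simps power2_eq_square power3_eq_cube power4_eq_xxxx)
  \<comment> \<open>All terms containing \<open>X'\<close> cancel, since \<open>q\<close> is the
    reciprocal of \<open>1 + geodesic_time t\<close>.\<close>
  also have "\<dots> = (D * q)\<^sup>2"
    unfolding V'V' V'V geodesic_space_norm using q by algebra
  finally have "norm (q *\<^sub>R V' + (- X' * q\<^sup>2) *\<^sub>R geodesic_space t) = D * q"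
    using D pos by (simp add: power2_eq_iff_nonneg q_def)
  then show ?thesis using d by (auto simp: q_def)
qed

lemma geodesic_length:
  "rectifiable_path geodesic" "path_image geodesic \<subseteq> ball 0 1"
  "arc_length_integral geodesic hyperbolic_density \<le> D"
proof -
  show im: "path_image geodesic \<subseteq> ball 0 1" using geodesic_density(2) by (auto simp: path_image_def)
  from choice[OF allI[OF geodesic_has_vector_derivative[where S = "{0..1}"]]]
  obtain \<gamma>' where "\<forall>t. (geodesic has_vector_derivative \<gamma>' t) (at t within {0..1}) \<and>
      norm (\<gamma>' t) = D / (1 + geodesic_time t)" ..
  then have \<gamma>': "(geodesic has_vector_derivative \<gamma>' t) (at t within {0..1})"
    "norm (\<gamma>' t) = D / (1 + geodesic_time t)" for t by auto
  have g: "continuous_on {0..1} (\<lambda>t. D / (1 + geodesic_time t))"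
    using geodesic_time_ge_1 unfolding geodesic_time_def
    by (intro continuous_intros) (smt (verit))
  have D': "hyperbolic_density (geodesic t) * (D / (1 + geodesic_time t)) \<le> D" for t
    unfolding geodesic_density(3) using geodesic_time_ge_1[of t] by simp
  note len = arc_length_integral_le_of_derivative[where \<gamma> = geodesic and \<gamma>' = \<gamma>' and w = hyperbolic_density
      and g = "\<lambda>t. D / (1 + geodesic_time t)" and D = D,
      OF \<gamma>'(1) g eq_refl[OF \<gamma>'(2)] continuous_on_densities(1)[OF im] densities_nonneg(1)[OF subsetD[OF im]] D']
  show "rectifiable_path geodesic" by (rule len(1))
  show "arc_length_integral geodesic hyperbolic_density \<le> D" by (rule len(2))
qed

end

text \<open>By the half-angle formula, \<open>C\<close> is the cosh of the hyperbolic distance, and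
  it is also the Minkowski product of the lifts of \<open>x\<close> and \<open>y\<close>. The
  geodesic through the two lifts therefore takes time \<open>arcosh C\<close>.\<close>

lemma hyperbolic_geodesic:
  fixes x y :: "'a::euclidean_space"
  assumes x: "x \<in> ball 0 1" and y: "y \<in> ball 0 1"
  defines "C \<equiv> 1 + 2 * (norm (x - y))\<^sup>2 / ((1 - (norm x)\<^sup>2) * (1 - (norm y)\<^sup>2))"
  shows "\<exists>\<gamma>\<in>joining_paths (ball 0 1) x y. arc_length_integral \<gamma> hyperbolic_density \<le> arcosh C"
proof (cases "x = y")
  case True
  \<comment> \<open>The constant curve; the construction of the initial velocity would divide by
    \<open>sinh 0\<close> here.\<close>
  have "rectifiable_path (\<lambda>_. x)" "arc_length_integral (\<lambda>_. x) hyperbolic_density \<le> 0"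
    using x densities_nonneg(1)[OF x]
    by (intro arc_length_integral_le_of_derivative[where \<gamma>' = "\<lambda>_. 0" and g = "\<lambda>_. 0"];
        auto simp: path_image_def)+
  then show ?thesis
    using True x by (auto simp: C_def joining_paths_def path_image_def pathstart_def pathfinish_def intro!: bexI[of _ "\<lambda>_. x"])
next
  case False
  \<comment> \<open>The lift of \<open>x\<close> is \<open>(p - 1, p x)\<close> and that of
    \<open>y\<close> is \<open>(q - 1, q y)\<close>.\<close>
  define p where "p = 2 / (1 - (norm x)\<^sup>2)"
  define q where "q = 2 / (1 - (norm y)\<^sup>2)"
  define D where "D = arcosh C"
  define S where "S = sinh D"
  define V where "V = p *\<^sub>R x"
  define W where "W = (1 / S) *\<^sub>R (q *\<^sub>R y - C *\<^sub>R V)"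
  \<comment> \<open>\<open>(w, W)\<close> is the initial velocity for which the geodesic reaches the lift of \<open>y\<close> at time \<open>D\<close>\<close>
  define w where "w = (1 / S) * ((q - 1) - C * (p - 1))"
  have nx: "(norm x)\<^sup>2 < 1" and ny: "(norm y)\<^sup>2 < 1" using x y norm_power2_less_1 by auto
  have p: "p \<ge> 2" "p * (1 - x \<bullet> x) = 2" and q: "q \<ge> 2" "q * (1 - y \<bullet> y) = 2"
    using nx ny by (auto simp: p_def q_def field_simps power2_norm_eq_inner)
  have C_eq: "C = 1 + p * q / 2 * ((x - y) \<bullet> (x - y))"
    unfolding C_def p_def q_def power2_norm_eq_inner[symmetric] by simp
  have C: "C > 1"
    unfolding C_eq using p(1) q(1) False by simp
  have CD: "cosh D = C" "D > 0"
    using C by (auto simp: D_def)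
  have S: "S > 0" "S\<^sup>2 = C\<^sup>2 - 1"
    using CD sinh_square_eq[of D] by (auto simp: S_def)
  have xx: "p * (x \<bullet> x) = p - 2" and yy: "q * (y \<bullet> y) = q - 2"
    using p(2) q(2) by (simp_all add: right_diff_distrib)
  \<comment> \<open>This exhibits \<open>C\<close> as the Minkowski product of the two
    lifts.\<close>
  have C_eq': "C = (p - 1) * (q - 1) - p * q * (x \<bullet> y)"
  proof -
    have "p * q * ((x - y) \<bullet> (x - y)) = q * (p * (x \<bullet> x)) + p * (q * (y \<bullet> y)) - 2 * p * q * (x \<bullet> y)"
      by (simp add: inner_diff_left inner_diff_right inner_commute algebra_simps)
    then have "p * q * ((x - y) \<bullet> (x - y)) = q * (p - 2) + p * (q - 2) - 2 * p * q * (x \<bullet> y)"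
      by (simp only: xx yy)
    moreover have "C = 1 + p * q * ((x - y) \<bullet> (x - y)) / 2" unfolding C_eq by simp
    ultimately show ?thesis by (simp add: field_simps)
  qed
  have VV: "V \<bullet> V = (p - 1)\<^sup>2 - 1"
    by (simp add: V_def xx) (simp add: power2_eq_square algebra_simps)
  have VY: "V \<bullet> (q *\<^sub>R y) = (p - 1) * (q - 1) - C"
    unfolding V_def C_eq' by (simp add: algebra_simps)
  have YY: "(q *\<^sub>R y) \<bullet> (q *\<^sub>R y) = (q - 1)\<^sup>2 - 1"
    by (simp add: yy) (simp add: power2_eq_square algebra_simps)
  have VW: "V \<bullet> W = (p - 1) * w"
  proof -
    have "V \<bullet> W = (1 / S) * (V \<bullet> (q *\<^sub>R y) - C * (V \<bullet> V))"
      by (simp add: W_def inner_diff_right)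
    also have "V \<bullet> (q *\<^sub>R y) - C * (V \<bullet> V) = (p - 1) * ((q - 1) - C * (p - 1))"
      unfolding VV VY by algebra
    finally show ?thesis by (simp add: w_def)
  qed
  \<comment> \<open>Subtracting \<open>C\<close> times the lift of \<open>x\<close> from the lift of
    \<open>y\<close> leaves a vector orthogonal to the former, of Minkowski square
    \<open>C^2 - 1\<close>; dividing by \<open>S\<close> makes it a unit vector.\<close>
  have "((q *\<^sub>R y) - C *\<^sub>R V) \<bullet> ((q *\<^sub>R y) - C *\<^sub>R V) = ((q - 1) - C * (p - 1))\<^sup>2 + S\<^sup>2"
  proof -
    have "((q *\<^sub>R y) - C *\<^sub>R V) \<bullet> ((q *\<^sub>R y) - C *\<^sub>R V) =
        (q *\<^sub>R y) \<bullet> (q *\<^sub>R y) - 2 * C * (V \<bullet> (q *\<^sub>R y)) + C\<^sup>2 * (V \<bullet> V)"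
      by (simp add: inner_diff_left inner_diff_right inner_commute power2_eq_square algebra_simps)
    also have "\<dots> = ((q - 1) - C * (p - 1))\<^sup>2 + S\<^sup>2"
      unfolding YY VY VV S(2) by algebra
    finally show ?thesis .
  qed
  moreover have "W \<bullet> W = (((q *\<^sub>R y) - C *\<^sub>R V) \<bullet> ((q *\<^sub>R y) - C *\<^sub>R V)) / S\<^sup>2"
    unfolding W_def inner_scaleR_left inner_scaleR_right by (simp only: power2_eq_square) simp
  ultimately have WW: "W \<bullet> W = w\<^sup>2 + 1"
    using S(1) by (simp add: w_def add_divide_distrib power_divide)
  have p1: "1 \<le> p - 1" using p by simp
  note geod = VV VW WW p1 less_imp_le[OF CD(2)]
  note geod_defs = geodesic_def[OF geod] geodesic_time_def[OF geod] geodesic_space_def[OF geod]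
  let ?\<gamma> = "geodesic V W (p - 1) w D"
  have "?\<gamma> 0 = x"
    unfolding geod_defs using p(1) by (simp add: V_def)
  moreover have "?\<gamma> 1 = y"
  proof -
    have "geodesic_time (p - 1) w D 1 = q - 1"
      unfolding geod_defs using S by (simp add: CD S_def[symmetric] w_def)
    moreover have "geodesic_space V W D 1 = q *\<^sub>R y"
      unfolding geod_defs using S by (simp add: CD S_def[symmetric] W_def)
    ultimately show ?thesis using q by (simp add: geod_defs(1))
  qed
  ultimately show ?thesis
    using geodesic_length[OF geod]
    by (intro bexI[of _ ?\<gamma>]) (auto simp: joining_paths_def pathstart_def pathfinish_def D_def)
qed

text \<open>With \<open>E = 1 + d / (1 - a)\<close> one has
  \<open>cosh (2 * ln E) = 1 + (E - 1 / E)^2 / 2\<close>. Replacing \<open>1 - b^2\<close> by the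
  smaller \<open>1 - a^2\<close> reduces the claim to
  \<open>2 * d / (1 - a^2) \<le> E - 1 / E\<close>.\<close>

lemma arcosh_le_2_ln:
  fixes a b d :: real
  assumes a: "0 \<le> b" "b \<le> a" "a < 1" and d: "0 \<le> d" "d \<le> a + b"
  shows "arcosh (1 + 2 * d\<^sup>2 / ((1 - a\<^sup>2) * (1 - b\<^sup>2))) \<le> 2 * ln (1 + d / (1 - a))"
proof -
  define u where "u = d / (1 - a)"
  define E where "E = 1 + u"
  have u: "u \<ge> 0" "d = u * (1 - a)" using assms by (auto simp: u_def)
  have E: "E \<ge> 1" using u by (simp add: E_def)
  have a2: "a\<^sup>2 < 1" using a by (simp add: abs_square_less_1)
  have b2: "b\<^sup>2 \<le> a\<^sup>2" using a by (intro power_mono) auto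
  have "2 * d / (1 - a\<^sup>2) \<le> E - 1 / E"
  proof -
    have "2 * d / (1 - a\<^sup>2) = 2 * u / (1 + a)"
      using a a2 unfolding u(2) by (simp add: field_simps power2_eq_square)
    also have "\<dots> \<le> u * (2 + u) / (1 + u)"
    proof -
      \<comment> \<open>Here \<open>d \<le> a + b\<close> enters: clearing denominators, the
        inequality amounts to \<open>u * (1 - a) \<le> 2 * a\<close>.\<close>
      have "u * (1 - a) \<le> 2 * a" using d a unfolding u(2) by linarith
      then have "u * (2 * (1 + u)) \<le> u * ((1 + a) * (2 + u))"
        using u(1) by (intro mult_left_mono) (auto simp: algebra_simps)
      then show ?thesis using u a by (simp add: divide_simps algebra_simps)
    qed
    also have "\<dots> = E - 1 / E"
      unfolding E_def using u by (simp add: field_simps)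
    finally show ?thesis .
  qed
  then have "(2 * d / (1 - a\<^sup>2))\<^sup>2 \<le> (E - 1 / E)\<^sup>2"
    using d a2 by (intro power_mono) auto
  moreover have "2 * d\<^sup>2 / ((1 - a\<^sup>2) * (1 - b\<^sup>2)) \<le> (2 * d / (1 - a\<^sup>2))\<^sup>2 / 2"
  proof -
    have "2 * d\<^sup>2 / ((1 - a\<^sup>2) * (1 - b\<^sup>2)) \<le> 2 * d\<^sup>2 / ((1 - a\<^sup>2) * (1 - a\<^sup>2))"
      using a2 b2 by (intro divide_left_mono mult_left_mono mult_pos_pos) auto
    then show ?thesis by (simp add: power_divide power_mult_distrib power2_eq_square)
  qed
  ultimately have le: "1 + 2 * d\<^sup>2 / ((1 - a\<^sup>2) * (1 - b\<^sup>2)) \<le> 1 + (E - 1 / E)\<^sup>2 / 2" by linarith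
  have cosh: "cosh (2 * ln E) = 1 + (E - 1 / E)\<^sup>2 / 2"
  proof -
    have "cosh (2 * ln E) = 1 + 2 * (sinh (ln E))\<^sup>2"
      using cosh_double[of "ln E"] cosh_square_eq[of "ln E"] by simp
    also have "sinh (ln E) = (E - 1 / E) / 2"
      using E by (simp add: sinh_ln_real inverse_eq_divide)
    finally show ?thesis by (simp add: power_divide)
  qed
  have ge1: "1 \<le> 1 + 2 * d\<^sup>2 / ((1 - a\<^sup>2) * (1 - b\<^sup>2))"
    using a2 b2 by simp
  have "arcosh (1 + 2 * d\<^sup>2 / ((1 - a\<^sup>2) * (1 - b\<^sup>2))) \<le> arcosh (cosh (2 * ln E))"
    unfolding cosh not_less[symmetric] using le ge1 by (subst arcosh_less_iff_real) auto
  also have "\<dots> = 2 * ln E" using E by (intro arcosh_cosh_real) simp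
  finally show ?thesis by (simp add: E_def u_def)
qed

section \<open>Curves in the ball and the infima over them\<close>

lemma joining_paths_ballD:
  assumes "\<gamma> \<in> joining_paths (ball 0 1) x y"
  shows "rectifiable_path \<gamma>" "path_image \<gamma> \<subseteq> ball 0 1" "\<gamma> 0 = x" "\<gamma> 1 = y"
    "continuous_on (path_image \<gamma>) hyperbolic_density" "continuous_on (path_image \<gamma>) quasihyperbolic_density"
    "0 \<le> arc_length_integral \<gamma> hyperbolic_density" "0 \<le> arc_length_integral \<gamma> quasihyperbolic_density"
    "\<And>u. 0 \<le> u \<Longrightarrow> u \<le> 1 \<Longrightarrow> norm (\<gamma> u) < 1"
proof -
  show *: "rectifiable_path \<gamma>" "path_image \<gamma> \<subseteq> ball 0 1" "\<gamma> 0 = x" "\<gamma> 1 = y"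
    using assms by (auto simp: joining_paths_def pathstart_def pathfinish_def)
  show "continuous_on (path_image \<gamma>) hyperbolic_density" "continuous_on (path_image \<gamma>) quasihyperbolic_density"
    using continuous_on_densities[OF *(2)] by auto
  show "0 \<le> arc_length_integral \<gamma> hyperbolic_density" "0 \<le> arc_length_integral \<gamma> quasihyperbolic_density"
    using *(2) densities_nonneg by (auto intro!: arc_length_integral_nonneg dest!: subsetD)
  show "norm (\<gamma> u) < 1" if "0 \<le> u" "u \<le> 1" for u
    using *(2) that by (auto simp: path_image_def image_subset_iff)
qed

lemma hyperbolic_dist_le:
  "\<gamma> \<in> joining_paths (ball 0 1) x y \<Longrightarrow> hyperbolic_dist x y \<le> arc_length_integral \<gamma> hyperbolic_density"
  unfolding hyperbolic_dist_def
  by (rule cINF_lower) (auto intro!: bdd_belowI2[where m = 0] joining_paths_ballD)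

lemma quasihyperbolic_dist_le:
  "\<gamma> \<in> joining_paths (ball 0 1) x y \<Longrightarrow> quasihyperbolic_dist x y \<le> arc_length_integral \<gamma> quasihyperbolic_density"
  unfolding quasihyperbolic_dist_def
  by (rule cINF_lower) (auto intro!: bdd_belowI2[where m = 0] joining_paths_ballD)

lemma joining_paths_ball_nonempty:
  "x \<in> ball 0 1 \<Longrightarrow> y \<in> ball 0 1 \<Longrightarrow> joining_paths (ball 0 1) x (y::'a::euclidean_space) \<noteq> {}"
  using hyperbolic_geodesic[of x y] by blast

section \<open>The comparisons of the metrics\<close>

lemma hyperbolic_dist_le_distance_ratio:
  fixes x y :: "'a::euclidean_space"
  assumes x: "x \<in> ball 0 1" and y: "y \<in> ball 0 1"
  shows "hyperbolic_dist x y \<le> 2 * distance_ratio x y"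
proof -
  obtain \<gamma> where \<gamma>: "\<gamma> \<in> joining_paths (ball 0 1) x y"
    "arc_length_integral \<gamma> hyperbolic_density
      \<le> arcosh (1 + 2 * (norm (x - y))\<^sup>2 / ((1 - (norm x)\<^sup>2) * (1 - (norm y)\<^sup>2)))"
    using hyperbolic_geodesic[OF x y] by blast
  have "hyperbolic_dist x y \<le> arcosh (1 + 2 * (norm (x - y))\<^sup>2 / ((1 - (norm x)\<^sup>2) * (1 - (norm y)\<^sup>2)))"
    using hyperbolic_dist_le[OF \<gamma>(1)] \<gamma>(2) by linarith
  also have "\<dots> \<le> 2 * distance_ratio x y"
  \<comment> \<open>The larger norm plays the part of \<open>a\<close>, so that \<open>1 - a\<close>
    is the minimum in \<open>distance_ratio\<close>.\<close>
  proof (cases "norm y \<le> norm x")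
    case True
    then show ?thesis
      using arcosh_le_2_ln[of "norm y" "norm x" "norm (x - y)"] x norm_triangle_ineq4[of x y]
      by (simp add: distance_ratio_def)
  next
    case False
    then show ?thesis
      using arcosh_le_2_ln[of "norm x" "norm y" "norm (x - y)"] y norm_triangle_ineq4[of x y]
      by (simp add: distance_ratio_def mult.commute add.commute)
  qed
  finally show ?thesis .
qed

text \<open>In the ball \<open>|z|^2 \<le> |z|\<close>, so the hyperbolic density is at most twice
  the quasihyperbolic one along every curve.\<close>

lemma hyperbolic_dist_le_quasihyperbolic_dist:
  fixes x y :: "'a::euclidean_space"
  assumes x: "x \<in> ball 0 1" and y: "y \<in> ball 0 1"
  shows "hyperbolic_dist x y \<le> 2 * quasihyperbolic_dist x y"
proof -
  have "hyperbolic_dist x y / 2 \<le> quasihyperbolic_dist x y"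
    unfolding quasihyperbolic_dist_def
  proof (rule cINF_greatest[OF joining_paths_ball_nonempty[OF x y]])
    fix \<gamma> assume \<gamma>: "\<gamma> \<in> joining_paths (ball 0 1) x y"
    note \<gamma>' = joining_paths_ballD[OF \<gamma>]
    have "arc_length_integral \<gamma> hyperbolic_density \<le> arc_length_integral \<gamma> (\<lambda>z. 2 * quasihyperbolic_density z)"
    proof (rule arc_length_integral_mono[OF \<gamma>'(1) _ \<gamma>'(1) \<gamma>'(5)])
      show "continuous_on (path_image \<gamma>) (\<lambda>z. 2 * quasihyperbolic_density z)"
        by (intro continuous_intros \<gamma>')
      fix u :: real assume u: "0 \<le> u" "u \<le> 1"
      have "norm (\<gamma> u) < 1" using \<gamma>'(9) u by blast
      then show "0 \<le> hyperbolic_density (\<gamma> u) \<and> hyperbolic_density (\<gamma> u) \<le> 2 * quasihyperbolic_density (\<gamma> u)"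
        using norm_power2_less_1[of "\<gamma> u"] mult_left_le[of "norm (\<gamma> u)" "norm (\<gamma> u)"]
        by (auto simp: power2_eq_square intro!: divide_left_mono)
    qed auto
    then show "hyperbolic_dist x y / 2 \<le> arc_length_integral \<gamma> quasihyperbolic_density"
      using hyperbolic_dist_le[OF \<gamma>] unfolding arc_length_integral_cmult by linarith
  qed
  then show ?thesis by simp
qed

lemma distance_ratio_le_quasihyperbolic_dist:
  fixes x y :: "'a::euclidean_space"
  assumes x: "x \<in> ball 0 1" and y: "y \<in> ball 0 1"
  shows "distance_ratio x y \<le> quasihyperbolic_dist x y"
  unfolding quasihyperbolic_dist_def
proof (rule cINF_greatest[OF joining_paths_ball_nonempty[OF x y]])
  fix \<gamma> assume \<gamma>: "\<gamma> \<in> joining_paths (ball 0 1) x y"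
  note \<gamma>' = joining_paths_ballD[OF \<gamma>]
  define F where "F = arc_length_fun \<gamma>"
  define d where "d = min (1 - norm x) (1 - norm y)"
  have d: "d > 0" using x y by (auto simp: d_def)
  have mono: "mono F" unfolding F_def by (rule arc_length_fun_mono[OF \<gamma>'(1)])
  have lim: "(\<lambda>n. stieltjes_sum (\<lambda>u. quasihyperbolic_density (\<gamma> u)) F c n) \<longlonglongrightarrow> arc_length_integral \<gamma> quasihyperbolic_density"
    if "0 \<le> c" "c \<le> 1" for c
    unfolding F_def by (rule stieltjes_sum_tendsto_arc_length_integral[OF \<gamma>'(1,6) that])
  have "distance_ratio x y \<le> ln (1 + (F 1 - F 0) / d)"
  proof -
    have "norm (x - y) \<le> F 1 - F 0"
      using dist_le_arc_length_fun[OF \<gamma>'(1), of 0 1] \<gamma>'(3,4) by (simp add: F_def dist_norm)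
    then have "norm (x - y) / d \<le> (F 1 - F 0) / d" "0 \<le> norm (x - y) / d"
      using d by (auto intro!: divide_right_mono)
    then show ?thesis
      unfolding distance_ratio_def d_def[symmetric] by (intro ln_mono) linarith+
  qed
  also have "\<dots> \<le> arc_length_integral \<gamma> quasihyperbolic_density"
  proof (cases "norm y \<le> norm x")
    \<comment> \<open>The start \<open>x\<close> is the end point nearer to the sphere, so length is
      measured from the start and left tags apply.\<close>
    case True
    have "1 / (d + F u - F 0) \<le> quasihyperbolic_density (\<gamma> u)" if u: "0 \<le> u" "u \<le> 1" for u
    proof (rule divide_left_mono)
      have "dist x (\<gamma> u) \<le> F u - F 0"
        using dist_le_arc_length_fun[OF \<gamma>'(1), of 0 u] u \<gamma>'(3) by (simp add: F_def)
      then show "1 - norm (\<gamma> u) \<le> d + F u - F 0"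
        using norm_triangle_ineq2[of x "\<gamma> u"] True by (simp add: d_def dist_norm)
      then show "0 < (d + F u - F 0) * (1 - norm (\<gamma> u))" using \<gamma>'(9)[OF u] by (intro mult_pos_pos) auto
    qed simp
    \<comment> \<open>The index starts at 1 to exclude the empty sum.\<close>
    then have "\<exists>N. \<forall>n\<ge>N. ln (1 + (F 1 - F 0) / d) \<le> stieltjes_sum (\<lambda>u. quasihyperbolic_density (\<gamma> u)) F 0 n"
      using stieltjes_sum_inverse_ge_ln(1)[OF mono d] by (intro exI[of _ 1]) auto
    then show ?thesis by (intro LIMSEQ_le_const[OF lim]) auto
  next
    \<comment> \<open>Now the end \<open>y\<close> is nearer to the sphere: length is measured
      backwards from it, with right tags.\<close>
    case False
    have "1 / (d + F 1 - F u) \<le> quasihyperbolic_density (\<gamma> u)" if u: "0 \<le> u" "u \<le> 1" for u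
    proof (rule divide_left_mono)
      have "dist (\<gamma> u) y \<le> F 1 - F u"
        using dist_le_arc_length_fun[OF \<gamma>'(1), of u 1] u \<gamma>'(4) by (simp add: F_def)
      then show "1 - norm (\<gamma> u) \<le> d + F 1 - F u"
        using norm_triangle_ineq2[of y "\<gamma> u"] False by (simp add: d_def dist_norm norm_minus_commute)
      then show "0 < (d + F 1 - F u) * (1 - norm (\<gamma> u))" using \<gamma>'(9)[OF u] by (intro mult_pos_pos) auto
    qed simp
    then have "\<exists>N. \<forall>n\<ge>N. ln (1 + (F 1 - F 0) / d) \<le> stieltjes_sum (\<lambda>u. quasihyperbolic_density (\<gamma> u)) F 1 n"
      using stieltjes_sum_inverse_ge_ln(2)[OF mono d] by (intro exI[of _ 1]) auto
    then show ?thesis by (intro LIMSEQ_le_const[OF lim]) auto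
  qed
  finally show "distance_ratio x y \<le> arc_length_integral \<gamma> quasihyperbolic_density" .
qed

lemma quasihyperbolic_dist_le_hyperbolic_dist:
  fixes x y :: "'a::euclidean_space"
  assumes x: "x \<in> ball 0 1" and y: "y \<in> ball 0 1"
  defines "r \<equiv> max (norm x) (norm y)"
  shows "quasihyperbolic_dist x y \<le> (1 + r) / 2 * hyperbolic_dist x y"
proof -
  have r: "0 \<le> r" "r < 1" "norm x \<le> r" "norm y \<le> r" using x y by (auto simp: r_def max_def)
  define P where "P = closest_point (cball (0::'a) r)"
  have ball: "convex (cball (0::'a) r)" "closed (cball (0::'a) r)" "cball (0::'a) r \<noteq> {}" using r by auto
  have P_lip: "dist (P u) (P v) \<le> dist u v" for u v
    unfolding P_def by (rule closest_point_lipschitz[OF ball])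
  have P_self: "P x = x" "P y = y" "P 0 = 0"
    using r by (auto simp: P_def intro!: closest_point_self)
  \<comment> \<open>The second bound is the contraction property against the fixed point 0.\<close>
  have P_norm: "norm (P z) \<le> r" "norm (P z) \<le> norm z" for z
    using closest_point_in_set[OF ball(2,3), of z] P_lip[of z 0] by (auto simp: P_def[symmetric] P_self)
  have "quasihyperbolic_dist x y / ((1 + r) / 2) \<le> hyperbolic_dist x y"
    unfolding hyperbolic_dist_def
  proof (rule cINF_greatest[OF joining_paths_ball_nonempty[OF x y]])
    fix \<gamma> assume \<gamma>: "\<gamma> \<in> joining_paths (ball 0 1) x y"
    note \<gamma>' = joining_paths_ballD[OF \<gamma>]
    have rect: "rectifiable_path (P \<circ> \<gamma>)"
      unfolding rectifiable_path_def path_def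
    proof
      show "continuous_on {0..1} (P \<circ> \<gamma>)"
        using \<gamma>'(1) unfolding P_def rectifiable_path_def path_def
        by (intro continuous_on_compose continuous_on_closest_point[OF ball]) blast
      show "bdd_above (inscribed_lengths (P \<circ> \<gamma>) 0 1)"
        by (intro arc_length_contraction(1) P_lip rectifiable_path_bdd[OF \<gamma>'(1)]) auto
    qed
    have im: "path_image (P \<circ> \<gamma>) \<subseteq> ball 0 1"
      using le_less_trans[OF P_norm(1) r(2)] by (auto simp: path_image_def)
    then have join: "P \<circ> \<gamma> \<in> joining_paths (ball 0 1) x y"
      using rect \<gamma>'(3,4) P_self by (auto simp: joining_paths_def pathstart_def pathfinish_def)
    have "arc_length_integral (P \<circ> \<gamma>) quasihyperbolic_density
        \<le> arc_length_integral \<gamma> (\<lambda>z. (1 + r) / 2 * hyperbolic_density z)"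
    proof (rule arc_length_integral_mono[OF \<gamma>'(1) _ rect joining_paths_ballD(6)[OF join]])
      show "continuous_on (path_image \<gamma>) (\<lambda>z. (1 + r) / 2 * hyperbolic_density z)"
        by (intro continuous_intros \<gamma>')
      show "arc_length (P \<circ> \<gamma>) s t \<le> arc_length \<gamma> s t" if "0 \<le> s" "s \<le> t" "t \<le> 1" for s t
        using that by (intro arc_length_contraction(2) P_lip rectifiable_path_bdd[OF \<gamma>'(1)])
      fix u :: real assume u: "0 \<le> u" "u \<le> 1"
      define m where "m = norm (\<gamma> u)"
      define n where "n = norm (P (\<gamma> u))"
      have m: "m < 1" using \<gamma>'(9) u by (simp add: m_def)
      have n: "0 \<le> n" "n \<le> r" "n \<le> m" using P_norm by (auto simp: n_def m_def)
      have "n\<^sup>2 \<le> m\<^sup>2" "m\<^sup>2 < 1" using m n by (auto simp: abs_square_less_1 intro!: power_mono)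
      \<comment> \<open>Expanding by \<open>1 + n\<close> brings the density into hyperbolic form;
        then \<open>n \<le> r\<close> bounds the numerator and \<open>n \<le> m\<close> the
        denominator.\<close>
      have "1 / (1 - n) = (1 + n) / (1 - n\<^sup>2)"
      proof -
        have "1 - n \<noteq> 0" "1 - n\<^sup>2 \<noteq> 0" using m n \<open>n\<^sup>2 \<le> m\<^sup>2\<close> \<open>m\<^sup>2 < 1\<close> by linarith+
        then show ?thesis by (simp add: frac_eq_eq) (simp add: power2_eq_square algebra_simps)
      qed
      also have "\<dots> \<le> (1 + r) / (1 - m\<^sup>2)"
        using n \<open>n\<^sup>2 \<le> m\<^sup>2\<close> \<open>m\<^sup>2 < 1\<close> by (intro frac_le) auto
      also have "\<dots> = (1 + r) / 2 * (2 / (1 - m\<^sup>2))" by (simp add: divide_simps) (simp add: algebra_simps)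
      finally show "0 \<le> quasihyperbolic_density ((P \<circ> \<gamma>) u) \<and>
          quasihyperbolic_density ((P \<circ> \<gamma>) u) \<le> (1 + r) / 2 * hyperbolic_density (\<gamma> u)"
        using m n unfolding m_def n_def comp_def by (intro conjI) simp_all
    qed
    then have "quasihyperbolic_dist x y \<le> (1 + r) / 2 * arc_length_integral \<gamma> hyperbolic_density"
      using quasihyperbolic_dist_le[OF join] unfolding arc_length_integral_cmult by linarith
    then show "quasihyperbolic_dist x y / ((1 + r) / 2) \<le> arc_length_integral \<gamma> hyperbolic_density"
      using r by (simp add: divide_le_eq mult.commute)
  qed
  then show ?thesis using r by (simp add: divide_le_eq mult.commute)
qed

theorem lemma2p6:
  fixes x y :: "real ^ 'n" and r :: real
  assumes "CARD('n) \<ge> 2"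
    and "x \<in> ball 0 1" and "y \<in> ball 0 1"
    and "r = max (norm x) (norm y)"
  shows "(1 / 2 * hyperbolic_dist x y \<le> distance_ratio x y \<and>
          distance_ratio x y \<le> (1 + r) / 2 * hyperbolic_dist x y) \<and>
         (1 / 2 * hyperbolic_dist x y \<le> quasihyperbolic_dist x y \<and>
          quasihyperbolic_dist x y \<le> (1 + r) / 2 * hyperbolic_dist x y)"
  using hyperbolic_dist_le_distance_ratio[OF assms(2,3)] hyperbolic_dist_le_quasihyperbolic_dist[OF assms(2,3)]
    distance_ratio_le_quasihyperbolic_dist[OF assms(2,3)] quasihyperbolic_dist_le_hyperbolic_dist[OF assms(2,3)]
  unfolding assms(4) by linarith

end
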